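(* Let $A_\Gamma$ be a right-angled Artin group with standard generating set $X=V(\Gamma)^{\pm1}$, let $\phi\in\mathrm{Aut}(A_\Gamma)$ be a composition of inversions, and let $A_\phi=A_\Gamma\rtimes_\phi\langle t\rangle$, where $t$ has finite order $m$, $\phi^m=\mathrm{id}$, and $t^{-1}xt=\phi(x)$ for all $x\in X$. Let $\widehat X=X\cup\{t^{\pm1}\}$ be the standard generating set of $A_\phi$. Then the language $\mathsf{ConjGeo}(A_\phi,\widehat X)$ is regular.
   Context: For a finite simple graph $\Gamma$, $A_\Gamma$ is the group generated by $V(\Gamma)$ with relations $st=ts$ whenever $\{s,t\}\in E(\Gamma)$. An inversion is the automorphism of $A_\Gamma$ sending one vertex $x\mapsto x^{-1}$ and fixing all other vertices. For a group $G$ with finite inverse-closed generating set $Y$, $\pi:Y^{\ast}\to G$ is the natural projection, $l(w)$ the word length, $|g|$ the length of a shortest word over $Y$ representing $g$, and $\mathsf{ConjGeo}(G,Y)=\{w\in Y^{\ast}: l(w)=\min\{|h|: h\text{ conjugate to }\pi(w)\text{ in }G\}\}$. *)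

theory Defs
  imports "HOL-Algebra.Algebra"
begin

section \<open>Group presentations\<close>

text \<open>A letter \<open>(x, True)\<close> stands for the generator \<open>x\<close> and \<open>(x, False)\<close> for its formal
  inverse. A relator pair \<open>(u, v)\<close> stands for the relation \<open>u = v\<close>.\<close>

type_synonym 'a signed_word = "('a \<times> bool) list"

inductive_set pres_cong ::
  "'a set \<Rightarrow> ('a signed_word \<times> 'a signed_word) set \<Rightarrow> ('a signed_word \<times> 'a signed_word) set"
  for S R where
  refl: "u \<in> lists (S \<times> UNIV) \<Longrightarrow> (u, u) \<in> pres_cong S R"
| sym: "(u, v) \<in> pres_cong S R \<Longrightarrow> (v, u) \<in> pres_cong S R"
| trans: "(u, v) \<in> pres_cong S R \<Longrightarrow> (v, w) \<in> pres_cong S R \<Longrightarrow> (u, w) \<in> pres_cong S R"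
| append: "(u, u') \<in> pres_cong S R \<Longrightarrow> (v, v') \<in> pres_cong S R \<Longrightarrow> (u @ v, u' @ v') \<in> pres_cong S R"
| cancel: "x \<in> S \<Longrightarrow> ([(x, b), (x, \<not> b)], []) \<in> pres_cong S R"
| rel: "(u, v) \<in> R \<Longrightarrow> u \<in> lists (S \<times> UNIV) \<Longrightarrow> v \<in> lists (S \<times> UNIV) \<Longrightarrow> (u, v) \<in> pres_cong S R"

definition presented_group ::
  "'a set \<Rightarrow> ('a signed_word \<times> 'a signed_word) set \<Rightarrow> 'a signed_word set monoid" where
  "presented_group S R =
    \<lparr>carrier = lists (S \<times> UNIV) // pres_cong S R,
     monoid.mult = (\<lambda>A B. \<Union>u\<in>A. \<Union>v\<in>B. pres_cong S R `` {u @ v}),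
     one = pres_cong S R `` {[]}\<rparr>"

lemma pres_cong_lists:
  "(u, v) \<in> pres_cong S R \<Longrightarrow> u \<in> lists (S \<times> UNIV) \<and> v \<in> lists (S \<times> UNIV)"
  by (induction rule: pres_cong.induct) auto

lemma equiv_pres_cong: "equiv (lists (S \<times> UNIV)) (pres_cong S R)"
proof (rule equivI)
  show "pres_cong S R \<subseteq> lists (S \<times> UNIV) \<times> lists (S \<times> UNIV)"
    using pres_cong_lists by fast
  show "refl_on (lists (S \<times> UNIV)) (pres_cong S R)"
    by (auto intro!: refl_onI pres_cong.refl)
  show "sym (pres_cong S R)"
    by (auto intro!: symI pres_cong.sym)
  show "trans (pres_cong S R)"
    by (auto intro!: transI intro: pres_cong.trans)
qed

lemma presented_mult_class:
  assumes "u \<in> lists (S \<times> UNIV)" "v \<in> lists (S \<times> UNIV)"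
  shows "(pres_cong S R `` {u}) \<otimes>\<^bsub>presented_group S R\<^esub> (pres_cong S R `` {v}) =
    pres_cong S R `` {u @ v}"
proof -
  have "congruent2 (pres_cong S R) (pres_cong S R) (\<lambda>u v. pres_cong S R `` {u @ v})"
    by (intro congruent2I' equiv_class_eq[OF equiv_pres_cong] pres_cong.append)
  then show ?thesis
    using UN_equiv_class2[OF equiv_pres_cong equiv_pres_cong _ assms]
    by (simp add: presented_group_def)
qed

lemma presented_carrierE:
  assumes "A \<in> carrier (presented_group S R)"
  obtains u where "u \<in> lists (S \<times> UNIV)" "A = pres_cong S R `` {u}"
proof -
  have "A \<in> lists (S \<times> UNIV) // pres_cong S R"
    using assms by (simp add: presented_group_def)
  then show thesis by (rule quotientE) (rule that)
qed

lemma presented_class_carrier: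
  "u \<in> lists (S \<times> UNIV) \<Longrightarrow> pres_cong S R `` {u} \<in> carrier (presented_group S R)"
  by (auto simp: presented_group_def intro: quotientI)

definition inv_word :: "'a signed_word \<Rightarrow> 'a signed_word" where
  "inv_word w = rev (map (\<lambda>(x, b). (x, \<not> b)) w)"

lemma inv_word_lists: "w \<in> lists (S \<times> UNIV) \<Longrightarrow> inv_word w \<in> lists (S \<times> UNIV)"
  by (auto simp: inv_word_def)

lemma pres_cong_inv_word:
  "w \<in> lists (S \<times> UNIV) \<Longrightarrow> (inv_word w @ w, []) \<in> pres_cong S R"
proof (induction w)
  case Nil
  show ?case by (simp add: inv_word_def pres_cong.refl)
next
  case (Cons a w)
  obtain x b where a: "a = (x, b)" by (cases a)
  have w: "w \<in> lists (S \<times> UNIV)" and x: "x \<in> S" using Cons.prems a by auto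
  have "([(x, \<not> b), (x, b)], []) \<in> pres_cong S R"
    using pres_cong.cancel[OF x, of "\<not> b"] by simp
  then have "([(x, \<not> b), (x, b)] @ w, [] @ w) \<in> pres_cong S R"
    by (rule pres_cong.append) (rule pres_cong.refl[OF w])
  then have "(inv_word w @ ([(x, \<not> b), (x, b)] @ w), inv_word w @ ([] @ w)) \<in> pres_cong S R"
    by (rule pres_cong.append[OF pres_cong.refl[OF inv_word_lists[OF w]]])
  with Cons.IH[OF w] have "(inv_word w @ [(x, \<not> b), (x, b)] @ w, []) \<in> pres_cong S R"
    by (auto intro: pres_cong.trans)
  then show ?case by (simp add: inv_word_def a)
qed

lemma group_presented_group: "group (presented_group S R)"
proof (rule groupI)
  let ?G = "presented_group S R"
  have one: "\<one>\<^bsub>?G\<^esub> = pres_cong S R `` {[]}" by (simp add: presented_group_def)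
  show "\<one>\<^bsub>?G\<^esub> \<in> carrier ?G" unfolding one by (rule presented_class_carrier) simp
  fix A assume "A \<in> carrier ?G"
  then obtain u where u: "u \<in> lists (S \<times> UNIV)" "A = pres_cong S R `` {u}"
    by (rule presented_carrierE)
  show "\<one>\<^bsub>?G\<^esub> \<otimes>\<^bsub>?G\<^esub> A = A"
    unfolding one u(2) using u(1) by (subst presented_mult_class) auto
  show "\<exists>B\<in>carrier ?G. B \<otimes>\<^bsub>?G\<^esub> A = \<one>\<^bsub>?G\<^esub>"
  proof
    show "pres_cong S R `` {inv_word u} \<in> carrier ?G"
      by (rule presented_class_carrier[OF inv_word_lists[OF u(1)]])
    show "(pres_cong S R `` {inv_word u}) \<otimes>\<^bsub>?G\<^esub> A = \<one>\<^bsub>?G\<^esub>"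
      unfolding u(2) one presented_mult_class[OF inv_word_lists[OF u(1)] u(1)]
      by (rule equiv_class_eq[OF equiv_pres_cong pres_cong_inv_word[OF u(1)]])
  qed
  fix B assume "B \<in> carrier ?G"
  then obtain v where v: "v \<in> lists (S \<times> UNIV)" "B = pres_cong S R `` {v}"
    by (rule presented_carrierE)
  show "A \<otimes>\<^bsub>?G\<^esub> B \<in> carrier ?G"
    unfolding u(2) v(2) presented_mult_class[OF u(1) v(1)]
    by (rule presented_class_carrier) (simp only: append_in_lists_conv u(1) v(1))
  fix C assume "C \<in> carrier ?G"
  then obtain w where w: "w \<in> lists (S \<times> UNIV)" "C = pres_cong S R `` {w}"
    by (rule presented_carrierE)
  have uv: "u @ v \<in> lists (S \<times> UNIV)" and vw: "v @ w \<in> lists (S \<times> UNIV)"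
    using u(1) v(1) w(1) by (simp_all only: append_in_lists_conv)
  show "(A \<otimes>\<^bsub>?G\<^esub> B) \<otimes>\<^bsub>?G\<^esub> C = A \<otimes>\<^bsub>?G\<^esub> (B \<otimes>\<^bsub>?G\<^esub> C)"
    unfolding u(2) v(2) w(2) presented_mult_class[OF u(1) v(1)] presented_mult_class[OF v(1) w(1)]
      presented_mult_class[OF uv w(1)] presented_mult_class[OF u(1) vw] append_assoc ..
qed


section \<open>Right-angled Artin groups\<close>

definition finite_simple_graph :: "'v set \<Rightarrow> 'v set set \<Rightarrow> bool" where
  "finite_simple_graph V E \<longleftrightarrow> finite V \<and> (\<forall>e\<in>E. \<exists>u\<in>V. \<exists>v\<in>V. u \<noteq> v \<and> e = {u, v})"

definition raag_rels :: "'v set set \<Rightarrow> ('v signed_word \<times> 'v signed_word) set" where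
  "raag_rels E =
    {([(s, True), (t, True)], [(t, True), (s, True)]) | s t. {s, t} \<in> E}"

definition raag :: "'v set \<Rightarrow> 'v set set \<Rightarrow> 'v signed_word set monoid" where
  "raag V E = presented_group V (raag_rels E)"

definition raag_gen :: "'v set \<Rightarrow> 'v set set \<Rightarrow> 'v \<Rightarrow> 'v signed_word set" where
  "raag_gen V E x = pres_cong V (raag_rels E) `` {[(x, True)]}"

definition raag_gens :: "'v set \<Rightarrow> 'v set set \<Rightarrow> 'v signed_word set set" where
  "raag_gens V E = raag_gen V E ` V \<union> (\<lambda>x. inv\<^bsub>raag V E\<^esub> raag_gen V E x) ` V"

definition inversions ::
  "'v set \<Rightarrow> 'v set set \<Rightarrow> ('v signed_word set \<Rightarrow> 'v signed_word set) set" where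
  "inversions V E = {\<sigma> \<in> carrier (AutoGroup (raag V E)). \<exists>x\<in>V.
     \<sigma> (raag_gen V E x) = inv\<^bsub>raag V E\<^esub> raag_gen V E x \<and>
     (\<forall>y\<in>V - {x}. \<sigma> (raag_gen V E y) = raag_gen V E y)}"

lemma group_raag: "group (raag V E)"
  by (simp add: raag_def group_presented_group)

lemma raag_gen_carrier: "x \<in> V \<Longrightarrow> raag_gen V E x \<in> carrier (raag V E)"
  by (auto simp: raag_def raag_gen_def intro: presented_class_carrier)


section \<open>Words over a subset of a group, and conjugacy geodesics\<close>

text \<open>The natural projection of the free monoid on a subset of \<open>G\<close>: the product of the letters.\<close>

definition word_val :: "('a, 'b) monoid_scheme \<Rightarrow> 'a list \<Rightarrow> 'a" where
  "word_val G w = foldr (\<otimes>\<^bsub>G\<^esub>) w \<one>\<^bsub>G\<^esub>"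

text \<open>Meaningful when \<open>Y\<close> generates \<open>G\<close> as a monoid; the infimum of the empty set of
  natural numbers is \<open>0\<close>.\<close>

definition word_norm :: "('a, 'b) monoid_scheme \<Rightarrow> 'a set \<Rightarrow> 'a \<Rightarrow> nat" where
  "word_norm G Y g = Inf (length ` {w \<in> lists Y. word_val G w = g})"

definition conj_class :: "('a, 'b) monoid_scheme \<Rightarrow> 'a \<Rightarrow> 'a set" where
  "conj_class G g = {inv\<^bsub>G\<^esub> k \<otimes>\<^bsub>G\<^esub> g \<otimes>\<^bsub>G\<^esub> k | k. k \<in> carrier G}"

definition ConjGeo :: "('a, 'b) monoid_scheme \<Rightarrow> 'a set \<Rightarrow> 'a list set" where
  "ConjGeo G Y =
    {w \<in> lists Y. length w = Inf (word_norm G Y ` conj_class G (word_val G w))}"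


section \<open>Regular languages\<close>

text \<open>\<open>L\<close> is the language of a deterministic finite automaton over the finite alphabet \<open>\<Sigma>\<close>.
  Taking the states to be natural numbers loses no generality, the state set being finite.\<close>

definition regular_language :: "'a set \<Rightarrow> 'a list set \<Rightarrow> bool" where
  "regular_language \<Sigma> L \<longleftrightarrow> finite \<Sigma> \<and>
    (\<exists>(Q :: nat set) q0 F \<delta>. finite Q \<and> q0 \<in> Q \<and> F \<subseteq> Q \<and> (\<forall>q\<in>Q. \<forall>a\<in>\<Sigma>. \<delta> q a \<in> Q) \<and>
       L = {w \<in> lists \<Sigma>. foldl \<delta> q0 w \<in> F})"


section \<open>Extensions by a finite cyclic group\<close>

definition semidirect_product ::
  "('a, 'c) monoid_scheme \<Rightarrow> ('b, 'd) monoid_scheme \<Rightarrow> ('b \<Rightarrow> 'a \<Rightarrow> 'a) \<Rightarrow> ('a \<times> 'b) monoid" where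
  "semidirect_product N H \<alpha> =
    \<lparr>carrier = carrier N \<times> carrier H,
     monoid.mult = (\<lambda>(n, h) (n', h'). (n \<otimes>\<^bsub>N\<^esub> \<alpha> h n', h \<otimes>\<^bsub>H\<^esub> h')),
     one = (\<one>\<^bsub>N\<^esub>, \<one>\<^bsub>H\<^esub>)\<rparr>"

text \<open>The pair \<open>(n, k)\<close> is \<open>n t\<^sup>k\<close>. The exponent \<open>- k\<close> in the action makes
  \<open>t\<^sup>-\<^sup>1 n t = \<phi> n\<close> (lemma \<open>cyclic_extension_conj\<close> below).\<close>

definition cyclic_extension :: "('a, 'c) monoid_scheme \<Rightarrow> ('a \<Rightarrow> 'a) \<Rightarrow> nat \<Rightarrow> ('a \<times> int) monoid" where
  "cyclic_extension N \<phi> m =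
    semidirect_product N (integer_mod_group m) (\<lambda>k. \<phi> [^]\<^bsub>AutoGroup N\<^esub> (- k))"

definition ext_embed :: "'a \<Rightarrow> 'a \<times> int" where
  "ext_embed n = (n, 0)"

text \<open>The residue \<open>1 mod m\<close> is \<open>0\<close> when \<open>m = 1\<close>.\<close>

definition ext_t :: "('a, 'c) monoid_scheme \<Rightarrow> nat \<Rightarrow> 'a \<times> int" where
  "ext_t N m = (\<one>\<^bsub>N\<^esub>, 1 mod int m)"

definition ext_raag_gens ::
  "'v set \<Rightarrow> 'v set set \<Rightarrow> ('v signed_word set \<Rightarrow> 'v signed_word set) \<Rightarrow> nat
    \<Rightarrow> ('v signed_word set \<times> int) set" where
  "ext_raag_gens V E \<phi> m = ext_embed ` raag_gens V E \<union>
    {ext_t (raag V E) m, inv\<^bsub>cyclic_extension (raag V E) \<phi> m\<^esub> ext_t (raag V E) m}"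

lemma AutoGroup_mult_apply:
  assumes "f \<in> carrier (AutoGroup N)" "g \<in> carrier (AutoGroup N)" "x \<in> carrier N"
  shows "(f \<otimes>\<^bsub>AutoGroup N\<^esub> g) x = f (g x)"
  using assms by (auto simp: AutoGroup_def BijGroup_def auto_def compose_def)

lemma AutoGroup_one_apply: "x \<in> carrier N \<Longrightarrow> \<one>\<^bsub>AutoGroup N\<^esub> x = x"
  by (simp add: AutoGroup_def BijGroup_def)

lemma AutoGroup_hom: "f \<in> carrier (AutoGroup N) \<Longrightarrow> f \<in> hom N N"
  by (simp add: AutoGroup_def auto_def)

lemma group_semidirect_product:
  assumes "group N" "group H" and \<alpha>: "\<alpha> \<in> hom H (AutoGroup N)"
  shows "group (semidirect_product N H \<alpha>)"
proof -
  interpret N: group N by fact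
  interpret H: group H by fact
  interpret \<alpha>: group_hom H "AutoGroup N" \<alpha>
    by (intro group_hom.intro group_hom_axioms.intro N.AutoGroup H.group_axioms \<alpha>)
  have aut: "\<alpha> h \<in> carrier (AutoGroup N)" if "h \<in> carrier H" for h
    using that by simp
  have cl: "\<alpha> h n \<in> carrier N" if "h \<in> carrier H" "n \<in> carrier N" for h n
    using AutoGroup_hom[OF aut[OF that(1)]] that(2) by (auto simp: hom_def)
  have dist: "\<alpha> h (n \<otimes>\<^bsub>N\<^esub> n') = \<alpha> h n \<otimes>\<^bsub>N\<^esub> \<alpha> h n'"
    if "h \<in> carrier H" "n \<in> carrier N" "n' \<in> carrier N" for h n n'
    using AutoGroup_hom[OF aut[OF that(1)]] that(2,3) by (auto simp: hom_def)
  have comp: "\<alpha> (h \<otimes>\<^bsub>H\<^esub> h') n = \<alpha> h (\<alpha> h' n)"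
    if "h \<in> carrier H" "h' \<in> carrier H" "n \<in> carrier N" for h h' n
    using that by (simp add: AutoGroup_mult_apply)
  have one: "\<alpha> \<one>\<^bsub>H\<^esub> n = n" if "n \<in> carrier N" for n
    using that by (simp add: AutoGroup_one_apply)
  have car: "carrier (semidirect_product N H \<alpha>) = carrier N \<times> carrier H"
    and mul: "\<And>n h n' h'. (n, h) \<otimes>\<^bsub>semidirect_product N H \<alpha>\<^esub> (n', h') =
      (n \<otimes>\<^bsub>N\<^esub> \<alpha> h n', h \<otimes>\<^bsub>H\<^esub> h')"
    and uni: "\<one>\<^bsub>semidirect_product N H \<alpha>\<^esub> = (\<one>\<^bsub>N\<^esub>, \<one>\<^bsub>H\<^esub>)"
    by (simp_all add: semidirect_product_def)
  show ?thesis
  proof (rule groupI, unfold car uni)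
    fix x assume "x \<in> carrier N \<times> carrier H"
    then obtain n h where x: "x = (n, h)" "n \<in> carrier N" "h \<in> carrier H"
      by blast
    show "\<exists>y\<in>carrier N \<times> carrier H. y \<otimes>\<^bsub>semidirect_product N H \<alpha>\<^esub> x = (\<one>\<^bsub>N\<^esub>, \<one>\<^bsub>H\<^esub>)"
    proof
      show "(inv\<^bsub>N\<^esub> (\<alpha> (inv\<^bsub>H\<^esub> h) n), inv\<^bsub>H\<^esub> h) \<otimes>\<^bsub>semidirect_product N H \<alpha>\<^esub> x = (\<one>\<^bsub>N\<^esub>, \<one>\<^bsub>H\<^esub>)"
        using x(2,3) cl by (simp add: x(1) mul del: \<alpha>.hom_inv)
      show "(inv\<^bsub>N\<^esub> (\<alpha> (inv\<^bsub>H\<^esub> h) n), inv\<^bsub>H\<^esub> h) \<in> carrier N \<times> carrier H"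
        using x(2,3) cl by (simp del: \<alpha>.hom_inv)
    qed
    show "(\<one>\<^bsub>N\<^esub>, \<one>\<^bsub>H\<^esub>) \<otimes>\<^bsub>semidirect_product N H \<alpha>\<^esub> x = x"
      using x one by (simp add: mul del: \<alpha>.hom_one)
    fix y assume "y \<in> carrier N \<times> carrier H"
    then obtain n' h' where y: "y = (n', h')" "n' \<in> carrier N" "h' \<in> carrier H"
      by blast
    show "x \<otimes>\<^bsub>semidirect_product N H \<alpha>\<^esub> y \<in> carrier N \<times> carrier H"
      using x y cl by (simp add: mul)
    fix z assume "z \<in> carrier N \<times> carrier H"
    then obtain n'' h'' where z: "z = (n'', h'')" "n'' \<in> carrier N" "h'' \<in> carrier H"
      by blast
    show "(x \<otimes>\<^bsub>semidirect_product N H \<alpha>\<^esub> y) \<otimes>\<^bsub>semidirect_product N H \<alpha>\<^esub> z =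
        x \<otimes>\<^bsub>semidirect_product N H \<alpha>\<^esub> (y \<otimes>\<^bsub>semidirect_product N H \<alpha>\<^esub> z)"
      using x y z by (simp add: mul cl dist comp N.m_assoc H.m_assoc del: \<alpha>.hom_mult)
  qed simp
qed

lemma int_pow_mod_eq:
  assumes "group G" "a \<in> carrier G" "a [^]\<^bsub>G\<^esub> m = \<one>\<^bsub>G\<^esub>"
  shows "a [^]\<^bsub>G\<^esub> (k mod int m) = a [^]\<^bsub>G\<^esub> (k :: int)"
proof -
  interpret group G by fact
  have "a [^]\<^bsub>G\<^esub> (int m * (k div int m)) = \<one>\<^bsub>G\<^esub>"
    using assms by (simp add: int_pow_pow[symmetric] int_pow_int)
  moreover have "k = int m * (k div int m) + k mod int m" by simp
  ultimately show ?thesis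
    using assms by (metis int_pow_closed int_pow_mult l_one)
qed

lemma cyclic_action_hom:
  assumes "group N" "\<phi> \<in> carrier (AutoGroup N)"
    "\<phi> [^]\<^bsub>AutoGroup N\<^esub> m = \<one>\<^bsub>AutoGroup N\<^esub>"
  shows "(\<lambda>k. \<phi> [^]\<^bsub>AutoGroup N\<^esub> (- k)) \<in> hom (integer_mod_group m) (AutoGroup N)"
proof -
  interpret A: group "AutoGroup N" using assms(1) by (rule group.AutoGroup)
  have "\<phi> [^]\<^bsub>AutoGroup N\<^esub> (- ((j + k) mod int m)) =
      \<phi> [^]\<^bsub>AutoGroup N\<^esub> (- j) \<otimes>\<^bsub>AutoGroup N\<^esub> \<phi> [^]\<^bsub>AutoGroup N\<^esub> (- k)" for j k :: int
  proof -
    have "\<phi> [^]\<^bsub>AutoGroup N\<^esub> (- ((j + k) mod int m)) =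
        inv\<^bsub>AutoGroup N\<^esub> (\<phi> [^]\<^bsub>AutoGroup N\<^esub> (j + k))"
      using assms by (simp add: A.int_pow_neg int_pow_mod_eq)
    also have "\<dots> = \<phi> [^]\<^bsub>AutoGroup N\<^esub> (- j + - k)"
      using assms(2) A.int_pow_neg[of \<phi> "j + k"] by simp
    finally show ?thesis by (simp only: A.int_pow_mult[OF assms(2)])
  qed
  then show ?thesis
    by (intro homI A.int_pow_closed assms(2)) (simp only: mult_integer_mod_group)
qed

lemma group_cyclic_extension:
  assumes "group N" "\<phi> \<in> carrier (AutoGroup N)"
    "\<phi> [^]\<^bsub>AutoGroup N\<^esub> m = \<one>\<^bsub>AutoGroup N\<^esub>"
  shows "group (cyclic_extension N \<phi> m)"
  unfolding cyclic_extension_def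
  by (intro group_semidirect_product cyclic_action_hom assms group_integer_mod_group)

lemma ext_t_carrier:
  assumes "group N" "m > 0"
  shows "ext_t N m \<in> carrier (cyclic_extension N \<phi> m)"
proof -
  interpret N: group N by fact
  show ?thesis using assms(2)
    by (simp add: ext_t_def cyclic_extension_def semidirect_product_def carrier_integer_mod_group)
qed

lemma cyclic_extension_conj:
  assumes "group N" and \<phi>: "\<phi> \<in> carrier (AutoGroup N)"
    and pow: "\<phi> [^]\<^bsub>AutoGroup N\<^esub> m = \<one>\<^bsub>AutoGroup N\<^esub>" and "m > 0" and n: "n \<in> carrier N"
  shows "inv\<^bsub>cyclic_extension N \<phi> m\<^esub> ext_t N m \<otimes>\<^bsub>cyclic_extension N \<phi> m\<^esub> ext_embed n
      \<otimes>\<^bsub>cyclic_extension N \<phi> m\<^esub> ext_t N m = ext_embed (\<phi> n)"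
proof -
  let ?G = "cyclic_extension N \<phi> m"
  interpret N: group N by fact
  interpret A: group "AutoGroup N" by (rule N.AutoGroup)
  interpret G: group ?G using group_cyclic_extension assms by blast
  have t: "ext_t N m \<in> carrier ?G" using ext_t_carrier assms by blast
  have \<phi>n: "\<phi> n \<in> carrier N" using AutoGroup_hom[OF \<phi>] n by (auto simp: hom_def)
  have e: "ext_embed x \<in> carrier ?G" if "x \<in> carrier N" for x
    using that \<open>m > 0\<close>
    by (simp add: ext_embed_def cyclic_extension_def semidirect_product_def carrier_integer_mod_group)
  have "\<phi> [^]\<^bsub>AutoGroup N\<^esub> (- (1 mod int m)) = inv\<^bsub>AutoGroup N\<^esub> \<phi>"
    using int_pow_mod_eq[OF A.group_axioms \<phi> pow, of 1] \<phi> by (simp add: A.int_pow_neg)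
  moreover have "(inv\<^bsub>AutoGroup N\<^esub> \<phi>) (\<phi> n) = n"
    using AutoGroup_mult_apply[of "inv\<^bsub>AutoGroup N\<^esub> \<phi>" N \<phi> n] \<phi> n
    by (simp add: AutoGroup_one_apply)
  ultimately have "ext_t N m \<otimes>\<^bsub>?G\<^esub> ext_embed (\<phi> n) = (n, 1 mod int m)"
    using \<phi>n n
    by (simp add: ext_t_def ext_embed_def cyclic_extension_def semidirect_product_def)
  also have "\<dots> = ext_embed n \<otimes>\<^bsub>?G\<^esub> ext_t N m"
    using n by (simp add: ext_t_def ext_embed_def cyclic_extension_def semidirect_product_def
        AutoGroup_one_apply)
  finally have eq: "ext_t N m \<otimes>\<^bsub>?G\<^esub> ext_embed (\<phi> n) = ext_embed n \<otimes>\<^bsub>?G\<^esub> ext_t N m" .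
  have "inv\<^bsub>?G\<^esub> ext_t N m \<otimes>\<^bsub>?G\<^esub> (ext_t N m \<otimes>\<^bsub>?G\<^esub> ext_embed (\<phi> n)) = ext_embed (\<phi> n)"
    using t e[OF \<phi>n] by (simp add: G.m_assoc[symmetric])
  then show ?thesis unfolding eq using t e[OF n] by (simp add: G.m_assoc)
qed

lemma (in monoid) word_val_append:
  assumes "u \<in> lists (carrier G)" "v \<in> lists (carrier G)"
  shows "word_val G (u @ v) = word_val G u \<otimes> word_val G v \<and> word_val G v \<in> carrier G"
proof -
  have cl: "word_val G w \<in> carrier G" if "w \<in> lists (carrier G)" for w
    using that by (induction w) (auto simp: word_val_def)
  have "word_val G (u @ v) = word_val G u \<otimes> word_val G v" using assms(1)
  proof (induction u)
    case Nil
    show ?case using cl[OF assms(2)] by (simp add: word_val_def)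
  next
    case (Cons a u)
    then have "a \<in> carrier G" "u \<in> lists (carrier G)" by auto
    with Cons.IH cl[OF assms(2)] cl[of u] show ?case
      by (simp add: word_val_def m_assoc)
  qed
  with cl[OF assms(2)] show ?thesis by blast
qed

lemma raag_gens_carrier: "raag_gens V E \<subseteq> carrier (raag V E)"
  unfolding raag_gens_def
  by (intro Un_least image_subsetI group.inv_closed[OF group_raag] raag_gen_carrier)

lemma raag_letter_gens:
  assumes "x \<in> V"
  shows "pres_cong V (raag_rels E) `` {[(x, b)]} \<in> raag_gens V E"
proof (cases b)
  case True
  then show ?thesis using assms by (auto simp: raag_gens_def raag_gen_def)
next
  case False
  let ?C = "\<lambda>u. pres_cong V (raag_rels E) `` {u}"
  have l: "[(x, c)] \<in> lists (V \<times> UNIV)" for c using assms by simp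
  have "?C [(x, False)] \<otimes>\<^bsub>raag V E\<^esub> raag_gen V E x = ?C ([(x, False)] @ [(x, True)])"
    unfolding raag_def raag_gen_def by (rule presented_mult_class[OF l l])
  also have "\<dots> = \<one>\<^bsub>raag V E\<^esub>"
    using equiv_class_eq[OF equiv_pres_cong pres_cong.cancel[OF assms, of False]]
    by (simp add: raag_def presented_group_def)
  finally have eq: "?C [(x, False)] \<otimes>\<^bsub>raag V E\<^esub> raag_gen V E x = \<one>\<^bsub>raag V E\<^esub>" .
  have "?C [(x, False)] \<in> carrier (raag V E)"
    unfolding raag_def by (rule presented_class_carrier[OF l])
  from group.inv_equality[OF group_raag eq raag_gen_carrier[OF assms] this]
  have "inv\<^bsub>raag V E\<^esub> raag_gen V E x = ?C [(x, False)]" .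
  then show ?thesis using False assms by (auto simp: raag_gens_def)
qed

lemma raag_generated:
  assumes "g \<in> carrier (raag V E)"
  shows "\<exists>w\<in>lists (raag_gens V E). word_val (raag V E) w = g"
proof -
  let ?C = "\<lambda>u. pres_cong V (raag_rels E) `` {u}"
  have "\<exists>w\<in>lists (raag_gens V E). word_val (raag V E) w = ?C u"
    if "u \<in> lists (V \<times> UNIV)" for u
    using that
  proof (induction u)
    case Nil
    have "word_val (raag V E) [] = ?C []"
      by (simp add: word_val_def raag_def presented_group_def)
    then show ?case by blast
  next
    case (Cons a u)
    obtain x b where a: "a = (x, b)" by (cases a)
    have x: "x \<in> V" and u: "u \<in> lists (V \<times> UNIV)" using Cons.hyps a by auto
    obtain w where w: "w \<in> lists (raag_gens V E)" "word_val (raag V E) w = ?C u"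
      using Cons.IH by blast
    have "[(x, b)] \<in> lists (V \<times> UNIV)" using x by simp
    then have "?C [(x, b)] \<otimes>\<^bsub>raag V E\<^esub> ?C u = ?C (a # u)"
      using presented_mult_class[of "[(x, b)]" V u] u by (simp add: raag_def a)
    then have "word_val (raag V E) (?C [(x, b)] # w) = ?C (a # u)"
      using w(2) by (simp add: word_val_def)
    moreover have "?C [(x, b)] # w \<in> lists (raag_gens V E)"
      using w(1) raag_letter_gens[OF x] by simp
    ultimately show ?case by blast
  qed
  moreover obtain u where "u \<in> lists (V \<times> UNIV)" "g = ?C u"
    using assms unfolding raag_def by (rule presented_carrierE)
  ultimately show ?thesis by blast
qed

lemma ext_raag_gens_generate:
  assumes "\<phi> \<in> carrier (AutoGroup (raag V E))"
    and "\<phi> [^]\<^bsub>AutoGroup (raag V E)\<^esub> m = \<one>\<^bsub>AutoGroup (raag V E)\<^esub>" and "m > 0"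
  shows "word_val (cyclic_extension (raag V E) \<phi> m) ` lists (ext_raag_gens V E \<phi> m) =
    carrier (cyclic_extension (raag V E) \<phi> m)"
proof -
  let ?A = "raag V E" and ?G = "cyclic_extension (raag V E) \<phi> m"
  let ?t = "ext_t ?A m"
  interpret A: group ?A by (rule group_raag)
  interpret G: group ?G by (rule group_cyclic_extension[OF group_raag assms(1,2)])
  have car: "carrier ?G = carrier ?A \<times> {0..<int m}" using assms(3)
    by (simp add: cyclic_extension_def semidirect_product_def carrier_integer_mod_group)
  have mul: "(n, h) \<otimes>\<^bsub>?G\<^esub> (n', h') =
      (n \<otimes>\<^bsub>?A\<^esub> (\<phi> [^]\<^bsub>AutoGroup ?A\<^esub> (- h)) n', (h + h') mod int m)" for n h n' h'
    by (simp add: cyclic_extension_def semidirect_product_def)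
  have one: "\<one>\<^bsub>?G\<^esub> = (\<one>\<^bsub>?A\<^esub>, 0)"
    by (simp add: cyclic_extension_def semidirect_product_def)
  interpret Aut: group "AutoGroup ?A" by (rule A.AutoGroup)
  have act1: "(\<phi> [^]\<^bsub>AutoGroup ?A\<^esub> (- h)) \<one>\<^bsub>?A\<^esub> = \<one>\<^bsub>?A\<^esub>" for h :: int
    using AutoGroup_hom[OF Aut.int_pow_closed[OF assms(1)]] hom_one group_raag by blast
  have act0: "(\<phi> [^]\<^bsub>AutoGroup ?A\<^esub> (- (0 :: int))) n = n" if "n \<in> carrier ?A" for n
    using that by (simp add: AutoGroup_one_apply)
  have t: "?t \<in> carrier ?G" by (rule ext_t_carrier[OF group_raag assms(3)])
  have sub: "ext_raag_gens V E \<phi> m \<subseteq> carrier ?G"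
    using t G.inv_closed[OF t] raag_gens_carrier[of V E] assms(3)
    unfolding ext_raag_gens_def by (auto simp: ext_embed_def car)
  have embed: "word_val ?G (map ext_embed w) = ext_embed (word_val ?A w) \<and>
      word_val ?A w \<in> carrier ?A" if "w \<in> lists (raag_gens V E)" for w
    using that
  proof (induction w)
    case Nil
    show ?case by (simp add: word_val_def ext_embed_def one)
  next
    case (Cons a w)
    have a: "a \<in> carrier ?A" using Cons.hyps raag_gens_carrier by blast
    have "word_val ?G (map ext_embed (a # w)) = ext_embed a \<otimes>\<^bsub>?G\<^esub> ext_embed (word_val ?A w)"
      using Cons.IH by (simp add: word_val_def)
    also have "\<dots> = ext_embed (a \<otimes>\<^bsub>?A\<^esub> word_val ?A w)"
      unfolding ext_embed_def mul using Cons.IH act0[of "word_val ?A w"] by simp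
    finally show ?case using Cons.IH a by (simp add: word_val_def)
  qed
  have tpow: "word_val ?G (replicate k ?t) = (\<one>\<^bsub>?A\<^esub>, int k mod int m)" for k
  proof (induction k)
    case 0
    show ?case by (simp add: word_val_def one)
  next
    case (Suc k)
    have "word_val ?G (replicate (Suc k) ?t) = ?t \<otimes>\<^bsub>?G\<^esub> (\<one>\<^bsub>?A\<^esub>, int k mod int m)"
      using Suc by (simp add: word_val_def)
    also have "\<dots> = (\<one>\<^bsub>?A\<^esub>, int (Suc k) mod int m)"
      unfolding ext_t_def mul act1 by (simp add: mod_simps)
    finally show ?case .
  qed
  show ?thesis
  proof
    show "word_val ?G ` lists (ext_raag_gens V E \<phi> m) \<subseteq> carrier ?G"
      using G.word_val_append[of "[]"] sub lists_mono by blast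
    show "carrier ?G \<subseteq> word_val ?G ` lists (ext_raag_gens V E \<phi> m)"
    proof
      fix g assume "g \<in> carrier ?G"
      then obtain n k where g: "g = (n, k)" "n \<in> carrier ?A" "0 \<le> k" "k < int m"
        unfolding car by auto
      obtain w where w: "w \<in> lists (raag_gens V E)" "word_val ?A w = n"
        using raag_generated[OF g(2)] by blast
      let ?u = "map ext_embed w" and ?v = "replicate (nat k) ?t"
      have u: "?u \<in> lists (ext_raag_gens V E \<phi> m)"
        using w(1) by (auto simp: ext_raag_gens_def)
      have v: "?v \<in> lists (ext_raag_gens V E \<phi> m)"
        by (auto simp: ext_raag_gens_def)
      have "word_val ?G (?u @ ?v) = word_val ?G ?u \<otimes>\<^bsub>?G\<^esub> word_val ?G ?v"
        using G.word_val_append[of ?u ?v] u v sub lists_mono by blast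
      also have "\<dots> = (n, 0) \<otimes>\<^bsub>?G\<^esub> (\<one>\<^bsub>?A\<^esub>, k)"
        using embed[OF w(1)] g by (simp add: tpow w(2) ext_embed_def)
      also have "\<dots> = g"
        unfolding mul act1 using g by simp
      finally have "g = word_val ?G (?u @ ?v)" ..
      moreover have "?u @ ?v \<in> lists (ext_raag_gens V E \<phi> m)"
        using u v by (simp only: append_in_lists_conv)
      ultimately show "g \<in> word_val ?G ` lists (ext_raag_gens V E \<phi> m)"
        by (rule image_eqI)
    qed
  qed
qed

end

theory Submission
  imports Defs
begin

text \<open>An element of the extension is \<open>n t\<^sup>k\<close> with \<open>n\<close> in the Artin group, and conjugating it by \<open>g t\<^sup>j\<close>
  replaces \<open>n\<close>, up to a power of \<open>\<phi>\<close>, by the twisted conjugate \<open>g\<^sup>-\<^sup>1 n \<psi>(g)\<close>, where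
  \<open>\<psi> = \<phi>\<^sup>-\<^sup>k\<close>. Since \<open>\<phi>\<close> is an involution that only flips the signs of some generators, it preserves length, and the
  length of \<open>n t\<^sup>k\<close> is the length of \<open>n\<close> plus a cost that depends on \<open>k\<close> alone. Hence a word is
  a conjugacy geodesic exactly if it spends the least number of letters \<open>t\<^sup>\<plusminus>\<^sup>1\<close> for its exponent
  and the word \<open>n\<close> that it spells in the Artin group is as short as all twisted conjugates of \<open>n\<close>
  (\<open>ConjGeo_iff\<close>).

  Minimality in a twisted conjugacy class is a local condition: it suffices that \<open>n\<close> is geodesic
  and that no single letter \<open>x\<close> makes \<open>x\<^sup>-\<^sup>1 n \<psi>(x)\<close> shorter
  (\<open>twisted_conjugacy_minimal\<close>). This is peak reduction: where a path of one-letter twisted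
  conjugations first rises and then falls, or rises and stays level, the two letters at the top
  commute, and performing them in the other order avoids the top (\<open>tconj_peak\<close>).

  The geometry of the Artin group enters through three facts about the geodesic length. One letter
  changes it by exactly one; two different first letters of an element commute and can be
  removed together (\<open>first_letter_pair\<close>); a first and a last letter can be removed together unless
  they are one and the same occurrence (\<open>first_last_letter\<close>). These come from normal forms: the
  group acts on reduced words up to shuffling of commuting letters, and the normal form of an element
  is the image of the empty word.

  Whether a word satisfies the local condition is decided by its set of first letters, its set of
  last letters, the letters that commute with it without shortening it, and the pairs of letters on
  the same vertex that shorten it from both ends. After one more letter these finitely many data
  depend only on their previous values and on that letter, again by the three facts
  (\<open>profile_snoc\<close>). Together with the exponent of \<open>t\<close> and a truncated count of the letters
  \<open>t\<^sup>\<plusminus>\<^sup>1\<close> they form a right congruence of finite index, so the language is regular.\<close>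

section \<open>Normal forms in right-angled Artin groups\<close>

definition letter_inv :: "'v \<times> bool \<Rightarrow> 'v \<times> bool" where
  "letter_inv a = (fst a, \<not> snd a)"

lemma letter_inv_simps [simp]:
  "letter_inv (letter_inv a) = a" "fst (letter_inv a) = fst a" "letter_inv a \<noteq> a" "a \<noteq> letter_inv a"
  "letter_inv a = letter_inv b \<longleftrightarrow> a = b"
  by (auto simp: letter_inv_def prod_eq_iff)

lemma letter_inv_eq_commute: "letter_inv a = b \<longleftrightarrow> a = letter_inv b"
  by (auto simp: letter_inv_def prod_eq_iff)

lemma inv_word_simps [simp]:
  "inv_word [] = []" "inv_word (a # w) = inv_word w @ [letter_inv a]"
  "inv_word (u @ v) = inv_word v @ inv_word u" "inv_word (inv_word w) = w"
  by (auto simp: inv_word_def letter_inv_def rev_map case_prod_unfold o_def)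

lemma length_inv_word [simp]: "length (inv_word w) = length w"
  by (simp add: inv_word_def)

text \<open>Without loops, commuting letters are neither equal nor inverse to each other. Words range over all
  letters of the type here; \<open>nf_pres_cong\<close> shows that normal forms stay inside a given vertex set.\<close>

locale loopfree_graph =
  fixes E :: "'v set set"
  assumes no_loop: "{v} \<notin> E"
begin

definition comm :: "'v \<times> bool \<Rightarrow> 'v \<times> bool \<Rightarrow> bool" where
  "comm a b \<longleftrightarrow> {fst a, fst b} \<in> E"

lemma comm_sym: "comm a b \<longleftrightarrow> comm b a"
  by (simp add: comm_def insert_commute)

lemma comm_inv [simp]: "comm (letter_inv a) b = comm a b" "comm a (letter_inv b) = comm a b"
  by (simp_all add: comm_def)

lemma comm_irrefl: "comm a b \<Longrightarrow> fst a \<noteq> fst b"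
  using no_loop by (auto simp: comm_def)

lemma comm_irrefl' [simp]: "\<not> comm a a"
  using comm_irrefl by blast

fun pull :: "'v \<times> bool \<Rightarrow> 'v signed_word \<Rightarrow> 'v signed_word option" where
  "pull a [] = None"
| "pull a (b # w) = (if a = b then Some w else if comm a b then map_option ((#) b) (pull a w) else None)"

text \<open>The action of a letter on reduced words: left multiplication followed by the free reduction,
  if any, that it makes possible.\<close>

definition lmult :: "'v \<times> bool \<Rightarrow> 'v signed_word \<Rightarrow> 'v signed_word" where
  "lmult a w = (case pull (letter_inv a) w of None \<Rightarrow> a # w | Some v \<Rightarrow> v)"

definition nf :: "'v signed_word \<Rightarrow> 'v signed_word" where
  "nf w = foldr lmult w []"

fun reduced :: "'v signed_word \<Rightarrow> bool" where
  "reduced [] = True"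
| "reduced (a # w) = (reduced w \<and> pull (letter_inv a) w = None)"

inductive swap :: "'v signed_word \<Rightarrow> 'v signed_word \<Rightarrow> bool" where
  here: "comm a b \<Longrightarrow> swap (a # b # w) (b # a # w)"
| Cons: "swap u v \<Longrightarrow> swap (a # u) (a # v)"

abbreviation shuffle (infix "\<sim>" 50) where "shuffle \<equiv> swap\<^sup>*\<^sup>*"

lemma swap_sym: "swap u v \<Longrightarrow> swap v u"
  by (induction rule: swap.induct) (auto intro: swap.intros simp: comm_sym)

lemma shuffle_sym: "u \<sim> v \<Longrightarrow> v \<sim> u"
  by (induction rule: rtranclp_induct) (auto intro: converse_rtranclp_into_rtranclp swap_sym)

lemma shuffle_Cons: "u \<sim> v \<Longrightarrow> a # u \<sim> a # v"
  by (induction rule: rtranclp_induct) (auto intro: rtranclp.rtrancl_into_rtrancl swap.Cons)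

lemma shuffle_length: "u \<sim> v \<Longrightarrow> length u = length v"
proof (induction rule: rtranclp_induct)
  case (step y z)
  have "length y = length z" using step(2) by (induction rule: swap.induct) auto
  with step show ?case by simp
qed simp

lemma pull_swap:
  "swap u v \<Longrightarrow> rel_option shuffle (pull x u) (pull x v)"
proof (induction rule: swap.induct)
  case (here a b w)
  have "a \<noteq> b" using here by auto
  with here show ?case
    by (cases "pull x w") (auto simp: comm_sym intro!: r_into_rtranclp swap.intros)
next
  case (Cons u v a)
  then show ?case
    by (auto simp: option_rel_Some1 option_rel_Some2 intro: shuffle_Cons
        elim!: option.rel_cases)
qed

lemma pull_shuffle: "u \<sim> v \<Longrightarrow> rel_option shuffle (pull x u) (pull x v)"
proof (induction rule: rtranclp_induct)
  case base
  show ?case by (cases "pull x u") auto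
next
  case (step y z)
  then show ?case using pull_swap[OF step(2), of x]
    by (auto elim!: option.rel_cases)
qed

lemma pull_to_front: "pull a w = Some v \<Longrightarrow> w \<sim> a # v"
proof (induction w arbitrary: v)
  case (Cons b w)
  show ?case
  proof (cases "a = b")
    case False
    with Cons obtain v' where v: "pull a w = Some v'" "v = b # v'" "comm a b"
      by (auto split: if_splits)
    have "b # w \<sim> b # a # v'" using Cons.IH[OF v(1)] by (rule shuffle_Cons)
    also have "\<dots> \<sim> a # b # v'"
      using v(3) by (auto simp: comm_sym intro!: r_into_rtranclp swap.here)
    finally show ?thesis using v by simp
  qed (use Cons in auto)
qed simp

lemma swap_reduced: "swap u v \<Longrightarrow> reduced u \<Longrightarrow> reduced v"
proof (induction rule: swap.induct)
  case (here a b w)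
  then show ?case using comm_irrefl[of a b] by (auto simp: comm_sym split: if_splits)
next
  case (Cons u v a)
  then show ?case using pull_swap[OF Cons(1), of "letter_inv a"]
    by auto
qed

lemma shuffle_reduced: "u \<sim> v \<Longrightarrow> reduced u \<Longrightarrow> reduced v"
  by (induction rule: rtranclp_induct) (auto intro: swap_reduced)

lemma pull_length: "pull a w = Some v \<Longrightarrow> length w = Suc (length v)"
  using shuffle_length[OF pull_to_front] by fastforce

text \<open>If two letters can both be brought to the front, the one that occurs later has been moved past the other.\<close>

lemma pull_pull:
  assumes "pull a w = Some u" "pull b w = Some v" "a \<noteq> b"
  shows "comm a b \<and> (\<exists>z. pull b u = Some z \<and> pull a v = Some z)"
  using assms
proof (induction w arbitrary: u v)
  case (Cons c w)
  show ?case
  proof (cases "a = c \<or> b = c")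
    case True
    with Cons show ?thesis by (auto simp: comm_sym split: if_splits)
  next
    case False
    with Cons.prems obtain u' v' where *: "pull a w = Some u'" "pull b w = Some v'"
      "u = c # u'" "v = c # v'" "comm a c" "comm b c"
      by (auto split: if_splits)
    from Cons.IH[OF *(1,2) Cons.prems(3)] * False show ?thesis by auto
  qed
qed simp

lemma pull_None_pull:
  "pull a w = Some u \<Longrightarrow> comm a b \<Longrightarrow> pull b w = None \<Longrightarrow> pull b u = None"
proof (induction w arbitrary: u)
  case (Cons c w)
  then show ?case by (auto simp: comm_sym split: if_splits)
qed simp

text \<open>The next four lemmas make \<open>lmult\<close> an action of the Artin group on reduced words modulo
  shuffling. Normal forms of equal elements are then shuffles of each other, without any confluence argument for
  rewriting.\<close>

lemma lmult_cong:
  assumes "u \<sim> v"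
  shows "lmult a u \<sim> lmult a v"
  using pull_shuffle[OF assms, of "letter_inv a"] shuffle_Cons[OF assms, of a]
  by (auto simp: lmult_def elim!: option.rel_cases)

lemma lmult_reduced: "reduced w \<Longrightarrow> reduced (lmult a w)"
  using shuffle_reduced[OF pull_to_front, of "letter_inv a" w]
  by (auto simp: lmult_def split: option.splits)

lemma lmult_inv:
  assumes "reduced w"
  shows "lmult a (lmult (letter_inv a) w) \<sim> w"
proof (cases "pull a w")
  case None
  then show ?thesis by (simp add: lmult_def)
next
  case (Some v)
  have "reduced (a # v)" by (rule shuffle_reduced[OF pull_to_front[OF Some] assms])
  then have "lmult a (lmult (letter_inv a) w) = a # v"
    using Some by (simp add: lmult_def)
  then show ?thesis using pull_to_front[OF Some] by (simp add: shuffle_sym)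
qed

text \<open>Shuffling is only needed when both letters are put in front; if one of them cancels, both orders
  of multiplication give the same word.\<close>

lemma lmult_commute:
  assumes ab: "comm a b"
  shows "lmult a (lmult b w) \<sim> lmult b (lmult a w)"
proof -
  have ne: "letter_inv a \<noteq> b" "letter_inv b \<noteq> a" "letter_inv a \<noteq> letter_inv b"
    using comm_irrefl[OF ab] by auto
  have c: "comm b a" using ab comm_sym by blast
  note d = lmult_def
  show ?thesis
  proof (cases "pull (letter_inv a) w")
    case A: None
    show ?thesis
    proof (cases "pull (letter_inv b) w")
      case None
      with A ne ab c show ?thesis
        by (auto simp: d intro!: r_into_rtranclp swap.here)
    next
      case (Some v)
      have "pull (letter_inv a) v = None" by (rule pull_None_pull[OF Some _ A]) (simp add: c)
      with A Some ne ab c show ?thesis by (simp add: d)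
    qed
  next
    case A: (Some u)
    show ?thesis
    proof (cases "pull (letter_inv b) w")
      case None
      have "pull (letter_inv b) u = None" by (rule pull_None_pull[OF A _ None]) (simp add: ab)
      with A None ne ab c show ?thesis by (simp add: d)
    next
      case (Some v)
      from pull_pull[OF A Some ne(3)] A Some show ?thesis by (auto simp: d)
    qed
  qed
qed

lemma foldr_lmult_cong: "u \<sim> v \<Longrightarrow> foldr lmult w u \<sim> foldr lmult w v"
  by (induction w) (auto intro: lmult_cong)

lemma foldr_lmult_reduced: "reduced u \<Longrightarrow> reduced (foldr lmult w u)"
  by (induction w) (auto intro: lmult_reduced)

lemma pres_cong_foldr_lmult:
  assumes "(u, v) \<in> pres_cong S (raag_rels E)" "reduced z"
  shows "foldr lmult u z \<sim> foldr lmult v z"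
  using assms
proof (induction arbitrary: z rule: pres_cong.induct)
  case (sym u v)
  then show ?case by (simp add: shuffle_sym)
next
  case (trans u v w)
  then show ?case by (meson rtranclp_trans)
next
  case (append u u' v v')
  have "foldr lmult u (foldr lmult v z) \<sim> foldr lmult u' (foldr lmult v z)"
    by (intro append.IH foldr_lmult_reduced append.prems)
  also have "\<dots> \<sim> foldr lmult u' (foldr lmult v' z)"
    by (intro foldr_lmult_cong append.IH append.prems)
  finally show ?case by simp
next
  case (cancel x b)
  then show ?case using lmult_inv[of z "(x, b)"] by (simp add: letter_inv_def)
next
  case (rel u v)
  then show ?case by (auto simp: raag_rels_def comm_def intro!: lmult_commute)
qed simp

definition glen :: "'v signed_word \<Rightarrow> nat" where
  "glen w = length (nf w)"

abbreviation cong (infix "\<doteq>" 50) where "u \<doteq> v \<equiv> (u, v) \<in> pres_cong UNIV (raag_rels E)"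

lemma pres_cong_glen: "(u, v) \<in> pres_cong S (raag_rels E) \<Longrightarrow> glen u = glen v"
  using shuffle_length[OF pres_cong_foldr_lmult[of u v S "[]"]] by (simp add: glen_def nf_def)

lemma nf_Cons: "nf (a # w) = lmult a (nf w)"
  by (simp add: nf_def)

lemma glen_Nil [simp]: "glen [] = 0"
  by (simp add: glen_def nf_def)

lemma glen_Cons_cases: "glen (a # w) = Suc (glen w) \<or> Suc (glen (a # w)) = glen w"
  by (auto simp: glen_def nf_Cons lmult_def dest: pull_length split: option.split)

lemma glen_le_length: "glen w \<le> length w"
proof (induction w)
  case (Cons a w)
  then show ?case using glen_Cons_cases[of a w] by simp linarith
qed simp

text \<open>If a letter cancelled on the way, the normal form would be shorter than the word.\<close>

lemma nf_geodesic: "glen w = length w \<Longrightarrow> nf w = w"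
proof (induction w)
  case (Cons a w)
  then have *: "glen (a # w) = Suc (glen w)" "glen w = length w"
    using glen_Cons_cases[of a w] glen_le_length[of w] by auto
  with Cons.IH have "nf w = w" by simp
  with *(1) show ?case
    by (auto simp: nf_Cons glen_def lmult_def dest: pull_length split: option.splits)
qed (simp add: nf_def)

lemma shorter_iff_pull: "glen (letter_inv a # w) < glen w \<longleftrightarrow> pull a (nf w) \<noteq> None"
  by (auto simp: glen_def nf_Cons lmult_def dest: pull_length split: option.splits)

section \<open>Geodesic length, first and last letters\<close>

lemma cong_refl [simp, intro]: "w \<doteq> w"
  by (rule pres_cong.refl) simp

lemma cong_append: "u \<doteq> u' \<Longrightarrow> v \<doteq> v' \<Longrightarrow> u @ v \<doteq> u' @ v'"
  by (rule pres_cong.append)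

lemma cong_Cons: "u \<doteq> v \<Longrightarrow> a # u \<doteq> a # v"
  using cong_append[of "[a]" "[a]" u v] by simp

lemma cong_inv_word_right: "w @ inv_word w \<doteq> []"
  using pres_cong_inv_word[of "inv_word w" UNIV "raag_rels E"] by simp

lemma cong_inv_word_left: "inv_word w @ w \<doteq> []"
  using pres_cong_inv_word[of "w" UNIV "raag_rels E"] by simp

lemma cong_cancel_mid: "p @ a # letter_inv a # q \<doteq> p @ q"
proof -
  have "[a] @ inv_word [a] \<doteq> []" by (rule cong_inv_word_right)
  then have "p @ ([a] @ inv_word [a]) @ q \<doteq> p @ [] @ q"
    by (intro cong_append cong_refl)
  then show ?thesis by simp
qed

lemma cong_cancel_mid': "p @ letter_inv a # a # q \<doteq> p @ q"
  using cong_cancel_mid[of p "letter_inv a" q] by simp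

lemma cong_inv_word:
  assumes "u \<doteq> v"
  shows "inv_word u \<doteq> inv_word v"
proof -
  have "inv_word u @ [] \<doteq> inv_word u @ v @ inv_word v"
    by (intro cong_append cong_refl pres_cong.sym[OF cong_inv_word_right])
  moreover have "inv_word u @ v @ inv_word v \<doteq> inv_word u @ u @ inv_word v"
    by (intro cong_append cong_refl pres_cong.sym[OF assms])
  moreover have "(inv_word u @ u) @ inv_word v \<doteq> [] @ inv_word v"
    by (intro cong_append cong_refl cong_inv_word_left)
  ultimately show ?thesis by (auto intro: pres_cong.trans)
qed

text \<open>The relators only commute positive generators; multiplying \<open>x y = y x\<close> by \<open>x\<^sup>-\<^sup>1\<close> on both sides
  gives the other signs.\<close>

lemma comm_pres_cong:
  assumes "comm a b" "fst a \<in> S" "fst b \<in> S"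
  shows "([a, b], [b, a]) \<in> pres_cong S (raag_rels E)"
proof -
  let ?R = "pres_cong S (raag_rels E)"
  have inv: "([letter_inv x, y], [y, letter_inv x]) \<in> ?R"
    if "([x, y], [y, x]) \<in> ?R" "fst x \<in> S" "fst y \<in> S" for x y
  proof -
    have cancel: "([z, letter_inv z], []) \<in> ?R" if "fst z \<in> S" for z
      using pres_cong.cancel[OF that, of "snd z"] by (simp add: letter_inv_def)
    have r: "(w, w) \<in> ?R" if "set w \<subseteq> {x, y, letter_inv x}" for w
      using that \<open>fst x \<in> S\<close> \<open>fst y \<in> S\<close>
      by (intro pres_cong.refl) (force simp: subset_iff in_lists_conv_set letter_inv_def)
    have "([letter_inv x, y] @ [], [letter_inv x, y] @ [x, letter_inv x]) \<in> ?R"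
      by (intro pres_cong.append r pres_cong.sym[OF cancel[OF that(2)]]) auto
    moreover have "([letter_inv x] @ [y, x] @ [letter_inv x], [letter_inv x] @ [x, y] @ [letter_inv x]) \<in> ?R"
      by (intro pres_cong.append r pres_cong.sym[OF that(1)]) auto
    moreover have "([letter_inv x, x] @ [y, letter_inv x], [] @ [y, letter_inv x]) \<in> ?R"
      using cancel[of "letter_inv x"] that(2) by (intro pres_cong.append r) auto
    ultimately show ?thesis by (auto intro: pres_cong.trans)
  qed
  have pos: "([(s, True), (t, True)], [(t, True), (s, True)]) \<in> ?R"
    if "{s, t} \<in> E" "s \<in> S" "t \<in> S" for s t
    using that by (intro pres_cong.rel) (auto simp: raag_rels_def)
  obtain s i t j where ab: "a = (s, i)" "b = (t, j)" by (cases a, cases b)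
  with assms have st: "{s, t} \<in> E" "s \<in> S" "t \<in> S" by (auto simp: comm_def)
  have 1: "([(s, i), (t, True)], [(t, True), (s, i)]) \<in> ?R"
    using pos[OF st] inv[OF pos[OF st]] st by (cases i) (auto simp: letter_inv_def)
  have "([(t, j), (s, i)], [(s, i), (t, j)]) \<in> ?R"
    using pres_cong.sym[OF 1] inv[OF pres_cong.sym[OF 1]] st by (cases j) (auto simp: letter_inv_def)
  then show ?thesis unfolding ab by (rule pres_cong.sym)
qed

lemma pull_pres_cong:
  assumes "pull a w = Some v" "w \<in> lists (S \<times> UNIV)"
  shows "(w, a # v) \<in> pres_cong S (raag_rels E) \<and> a # v \<in> lists (S \<times> UNIV)"
  using assms
proof (induction w arbitrary: v)
  case (Cons b w)
  show ?case
  proof (cases "a = b")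
    case False
    with Cons obtain v' where v: "pull a w = Some v'" "v = b # v'" "comm a b"
      by (auto split: if_splits)
    have w: "w \<in> lists (S \<times> UNIV)" and b: "b \<in> S \<times> UNIV" using Cons.prems by auto
    note IH = Cons.IH[OF v(1) w]
    then have a: "a \<in> S \<times> UNIV" and v': "v' \<in> lists (S \<times> UNIV)" by auto
    have "([b] @ w, [b] @ a # v') \<in> pres_cong S (raag_rels E)"
      using IH b by (intro pres_cong.append pres_cong.refl) auto
    moreover have "([b, a] @ v', [a, b] @ v') \<in> pres_cong S (raag_rels E)"
      using a b v' v(3) by (intro pres_cong.append pres_cong.refl comm_pres_cong)
        (auto simp: comm_sym mem_Times_iff)
    ultimately show ?thesis using v a b v' by (auto intro: pres_cong.trans)
  qed (use Cons.prems pres_cong.refl[of "b # w" S] in simp)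
qed simp

lemma nf_pres_cong:
  assumes "w \<in> lists (S \<times> UNIV)"
  shows "(w, nf w) \<in> pres_cong S (raag_rels E)"
  using assms
proof (induction w)
  case Nil
  then show ?case by (simp add: nf_def pres_cong.refl)
next
  case (Cons a w)
  let ?R = "pres_cong S (raag_rels E)"
  have a: "a \<in> S \<times> UNIV" and w: "(w, nf w) \<in> ?R" using Cons by auto
  have l: "nf w \<in> lists (S \<times> UNIV)" using pres_cong_lists[OF w] by simp
  have *: "(a # w, a # nf w) \<in> ?R"
    using pres_cong.append[OF pres_cong.refl w, of "[a]"] a by simp
  show ?case
  proof (cases "pull (letter_inv a) (nf w)")
    case None
    then show ?thesis using * by (simp add: nf_Cons lmult_def)
  next
    case (Some v)
    note p = pull_pres_cong[OF Some l]
    have "([a] @ nf w, [a] @ letter_inv a # v) \<in> ?R"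
      using p a by (intro pres_cong.append pres_cong.refl) auto
    moreover have "([a, letter_inv a] @ v, [] @ v) \<in> ?R"
      using p a pres_cong.cancel[of "fst a" S "snd a"]
      by (intro pres_cong.append pres_cong.refl) (auto simp: letter_inv_def)
    ultimately show ?thesis using * Some by (auto simp: nf_Cons lmult_def intro: pres_cong.trans)
  qed
qed

lemma cong_nf: "w \<doteq> nf w"
  by (rule nf_pres_cong) simp

lemma glen_cong: "u \<doteq> v \<Longrightarrow> glen u = glen v"
  by (rule pres_cong_glen)

lemma glen_inv_word [simp]: "glen (inv_word w) = glen w"
proof -
  have le: "glen (inv_word w) \<le> glen w" for w
    using glen_cong[OF cong_inv_word[OF cong_nf[of w]]] glen_le_length[of "inv_word (nf w)"]
    by (simp add: glen_def[of w])
  from le[of w] le[of "inv_word w"] show ?thesis by simp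
qed

lemma glen_snoc: "glen (w @ [a]) = glen (letter_inv a # inv_word w)"
  using glen_inv_word[of "w @ [a]"] by simp

lemma glen_snoc_cases: "glen (w @ [a]) = Suc (glen w) \<or> Suc (glen (w @ [a])) = glen w"
  using glen_Cons_cases[of "letter_inv a" "inv_word w"] by (simp add: glen_snoc)

definition first_letter :: "'v \<times> bool \<Rightarrow> 'v signed_word \<Rightarrow> bool" where
  "first_letter a w \<longleftrightarrow> glen (letter_inv a # w) < glen w"

definition last_letter :: "'v \<times> bool \<Rightarrow> 'v signed_word \<Rightarrow> bool" where
  "last_letter a w \<longleftrightarrow> glen (w @ [letter_inv a]) < glen w"

lemma last_letter_inv_word: "last_letter a w \<longleftrightarrow> first_letter (letter_inv a) (inv_word w)"
  by (simp add: last_letter_def first_letter_def glen_snoc)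

text \<open>Both letters occur in the normal form and can be brought to its front one after the other.\<close>

lemma first_letter_pair:
  assumes "first_letter a w" "first_letter b w" "a \<noteq> b"
  shows "comm a b" "glen (letter_inv b # letter_inv a # w) + 2 = glen w"
proof -
  from assms obtain u v where uv: "pull a (nf w) = Some u" "pull b (nf w) = Some v"
    by (auto simp: first_letter_def shorter_iff_pull)
  from pull_pull[OF this assms(3)] obtain z where z: "comm a b" "pull b u = Some z" by blast
  show "comm a b" by fact
  show "glen (letter_inv b # letter_inv a # w) + 2 = glen w"
    using uv z pull_length[OF uv(1)] pull_length[OF z(2)]
    by (simp add: glen_def nf_Cons lmult_def)
qed

lemma last_letter_pair:
  assumes "last_letter a w" "last_letter b w" "a \<noteq> b"
  shows "comm a b" "glen (w @ [letter_inv a, letter_inv b]) + 2 = glen w"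
proof -
  note fp = first_letter_pair[of "letter_inv a" "inv_word w" "letter_inv b"]
  from fp(1) assms show "comm a b" by (simp add: last_letter_inv_word)
  have "glen (w @ [letter_inv a, letter_inv b]) = glen (b # a # inv_word w)"
    using glen_inv_word[of "w @ [letter_inv a, letter_inv b]"] by simp
  with fp(2) assms show "glen (w @ [letter_inv a, letter_inv b]) + 2 = glen w"
    by (simp add: last_letter_inv_word)
qed

lemma pull_snoc:
  "pull a (u @ [b]) = Some v \<Longrightarrow>
    (\<exists>v'. pull a u = Some v' \<and> v = v' @ [b]) \<or> (pull a u = None \<and> a = b \<and> v = u)"
proof (induction u arbitrary: v)
  case (Cons c u)
  then show ?case by (auto split: if_splits)
qed (auto split: if_splits)

text \<open>Writing \<open>w\<close> as a geodesic that ends in \<open>b\<close>, either \<open>a\<close> occurs in it before this final \<open>b\<close>,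
  and both can be removed, or \<open>a\<close> is the final \<open>b\<close>, pulled to the front past everything else, and
  then \<open>a\<close> commutes with \<open>w\<close>.\<close>

lemma first_last_letter:
  assumes "first_letter a w" "last_letter b w"
  shows "glen (letter_inv a # w @ [letter_inv b]) + 2 = glen w \<or>
    a = b \<and> a # w @ [letter_inv a] \<doteq> w \<and> w @ [letter_inv a] \<doteq> letter_inv a # w \<and>
    glen (letter_inv a # w @ [letter_inv a]) = glen w"
proof -
  let ?h = "w @ [letter_inv b]"
  let ?u = "nf ?h @ [b]"
  have Nh: "Suc (glen ?h) = glen w"
    using assms(2) glen_snoc_cases[of w "letter_inv b"] by (auto simp: last_letter_def)
  have hu: "?h @ [b] \<doteq> ?u" by (intro cong_append cong_nf cong_refl)
  have hw: "?h @ [b] \<doteq> w" using cong_cancel_mid'[of w b "[]"] by simp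
  have wu: "w \<doteq> ?u" using hu hw by (meson pres_cong.sym pres_cong.trans)
  have Nu: "glen ?u = glen w" by (rule glen_cong[OF pres_cong.sym[OF wu]])
  then have "glen ?u = length ?u" using Nh by (simp add: glen_def[of ?h])
  then have nfu: "nf ?u = ?u" by (rule nf_geodesic)
  have "glen (letter_inv a # ?u) < glen ?u"
    using glen_cong[OF cong_Cons[OF wu, of "letter_inv a"]] assms(1) Nu by (simp add: first_letter_def)
  then obtain v where "pull a ?u = Some v" by (auto simp: shorter_iff_pull nfu)
  from pull_snoc[OF this] show ?thesis
  proof
    assume "\<exists>v'. pull a (nf ?h) = Some v' \<and> v = v' @ [b]"
    then have "glen (letter_inv a # ?h) < glen ?h" by (auto simp: shorter_iff_pull)
    then have "glen (letter_inv a # ?h) + 2 = glen w"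
      using Nh glen_Cons_cases[of "letter_inv a" ?h] by auto
    then show ?thesis by simp
  next
    assume *: "pull a (nf ?h) = None \<and> a = b \<and> v = nf ?h"
    \<comment> \<open>The pulled occurrence is the final letter itself.\<close>
    have "?u \<doteq> a # v"
      using pull_pres_cong[OF \<open>pull a ?u = Some v\<close>, of UNIV] by simp
    moreover have "a # v \<doteq> a # ?h"
      unfolding conjunct2[OF conjunct2[OF *]] by (rule cong_Cons[OF pres_cong.sym[OF cong_nf]])
    ultimately have w: "w \<doteq> a # w @ [letter_inv a]"
      using wu * by (auto intro: pres_cong.trans)
    have "letter_inv a # w \<doteq> letter_inv a # a # w @ [letter_inv a]"
      by (rule cong_Cons[OF w])
    moreover have "letter_inv a # a # w @ [letter_inv a] \<doteq> w @ [letter_inv a]"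
      using cong_cancel_mid'[of "[]" a "w @ [letter_inv a]"] by simp
    ultimately have iw: "w @ [letter_inv a] \<doteq> letter_inv a # w"
      by (meson pres_cong.sym pres_cong.trans)
    have "\<not> glen (letter_inv a # ?h) < glen ?h" using * by (auto simp: shorter_iff_pull)
    then have "glen (letter_inv a # ?h) = glen w"
      using Nh glen_Cons_cases[of "letter_inv a" ?h] by auto
    then show ?thesis using * w iw by (auto intro: pres_cong.sym)
  qed
qed

end

section \<open>Minimal elements of twisted conjugacy classes\<close>

text \<open>The action on letters of the composition of the inversions at the vertices in \<open>T\<close>.\<close>

definition flip :: "'v set \<Rightarrow> 'v \<times> bool \<Rightarrow> 'v \<times> bool" where
  "flip T a = (fst a, snd a \<noteq> (fst a \<in> T))"

lemma flip_simps [simp]: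
  "fst (flip T a) = fst a" "flip T (flip T a) = a" "flip T (letter_inv a) = letter_inv (flip T a)"
  "flip T a = flip T b \<longleftrightarrow> a = b" "flip {} = (\<lambda>a. a)"
  by (auto simp: flip_def letter_inv_def prod_eq_iff fun_eq_iff)

context loopfree_graph
begin

lemma comm_flip [simp]: "comm (flip T a) b = comm a b" "comm a (flip T b) = comm a b"
  by (simp_all add: comm_def)

text \<open>Twisted conjugation by one letter; with \<open>T = {}\<close> it is ordinary conjugation.\<close>

definition tconj :: "'v set \<Rightarrow> 'v \<times> bool \<Rightarrow> 'v signed_word \<Rightarrow> 'v signed_word" where
  "tconj T x w = letter_inv x # w @ [flip T x]"

lemma tconj_cong: "u \<doteq> v \<Longrightarrow> tconj T x u \<doteq> tconj T x v"
  unfolding tconj_def by (intro cong_Cons cong_append cong_refl)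

lemma tconj_inv: "tconj T (letter_inv x) (tconj T x w) \<doteq> w"
proof -
  have "[] @ x # letter_inv x # (w @ [flip T x, letter_inv (flip T x)]) \<doteq> [] @ w @ [flip T x, letter_inv (flip T x)]"
    by (rule cong_cancel_mid)
  moreover have "w @ flip T x # letter_inv (flip T x) # [] \<doteq> w @ []"
    by (rule cong_cancel_mid)
  ultimately show ?thesis by (auto simp: tconj_def intro: pres_cong.trans)
qed

lemma cong_swap_mid:
  assumes "comm a b"
  shows "p @ a # b # q \<doteq> p @ b # a # q"
proof -
  have "p @ [a, b] @ q \<doteq> p @ [b, a] @ q"
    using assms by (intro cong_append cong_refl comm_pres_cong) auto
  then show ?thesis by simp
qed

lemma tconj_commute:
  assumes "comm x y"
  shows "tconj T x (tconj T y w) \<doteq> tconj T y (tconj T x w)"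
proof -
  let ?a = "letter_inv x" and ?b = "letter_inv y"
  have "[] @ ?a # ?b # w @ [flip T y, flip T x] \<doteq> [] @ ?b # ?a # w @ [flip T y, flip T x]"
    using assms by (intro cong_swap_mid) simp
  moreover have "(?b # ?a # w) @ flip T y # flip T x # [] \<doteq> (?b # ?a # w) @ flip T x # flip T y # []"
    using assms by (intro cong_swap_mid) (simp add: comm_sym)
  ultimately show ?thesis by (auto simp: tconj_def intro: pres_cong.trans)
qed

lemma tconj_shorter:
  assumes "glen (tconj T x w) < glen w"
  shows "first_letter x w" "last_letter (letter_inv (flip T x)) w"
    "glen (tconj T x w) + 2 = glen w"
  using assms glen_Cons_cases[of "letter_inv x" w] glen_Cons_cases[of "letter_inv x" "w @ [flip T x]"]
    glen_snoc_cases[of w "flip T x"] glen_snoc_cases[of "letter_inv x # w" "flip T x"]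
  by (auto simp: tconj_def first_letter_def last_letter_def)

text \<open>Write \<open>\<psi>\<close> for \<open>flip T\<close>. If \<open>y\<close> is no first letter and \<open>\<psi>(y)\<^sup>-\<^sup>1\<close> no last letter of \<open>w\<close>, each of the two
  multiplications lengthens \<open>w\<close>, but the result can still have the length of \<open>w\<close>: then the two new letters
  cancel each other across \<open>w\<close>, and the twisted conjugate is \<open>w\<close> itself.\<close>

lemma tconj_not_longer:
  assumes "glen (tconj T y w) \<le> glen w"
  shows "first_letter y w \<or> last_letter (letter_inv (flip T y)) w \<or> tconj T y w \<doteq> w"
proof (rule ccontr)
  assume neg: "\<not> ?thesis"
  \<comment> \<open>Multiplying \<open>y\<^sup>-\<^sup>1 w\<close> by \<open>\<psi>(y)\<close> shortens it, and so does cancelling its first letter.\<close>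
  let ?u = "letter_inv y # w"
  have y: "\<not> first_letter y w" and z: "\<not> last_letter (letter_inv (flip T y)) w" using neg by auto
  have Nu: "glen ?u = Suc (glen w)"
    using y glen_Cons_cases[of "letter_inv y" w] by (auto simp: first_letter_def)
  have Nz: "glen (w @ [flip T y]) = Suc (glen w)"
    using z glen_snoc_cases[of w "flip T y"] by (auto simp: last_letter_def)
  have can: "[y] @ ?u \<doteq> w" using cong_cancel_mid[of "[]" y w] by simp
  have 1: "first_letter (letter_inv y) ?u"
    using Nu glen_cong[OF can] by (simp add: first_letter_def)
  have 2: "last_letter (letter_inv (flip T y)) ?u"
    using Nu assms by (simp add: last_letter_def tconj_def)
  have 3: "letter_inv (letter_inv y) # ?u @ [letter_inv (letter_inv (flip T y))] \<doteq> w @ [flip T y]"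
    using cong_append[OF can, of "[flip T y]" "[flip T y]"] by simp
  have fy: "flip T y = y" and "?u @ [y] \<doteq> y # ?u"
    using first_last_letter[OF 1 2] glen_cong[OF 3] Nz Nu by auto
  then have "tconj T y w \<doteq> w" using can by (auto simp: tconj_def intro: pres_cong.trans)
  with neg show False by simp
qed

text \<open>The peak reduction step. Shortening by \<open>x\<close> removes a first and a last letter. If \<open>y\<close> also removes
  a letter at one end, it commutes with the letter that \<open>x\<close> removes there, so it still removes
  one at that end after the conjugation by \<open>x\<close>. Three letters are then gone, and the multiplication by \<open>y\<close> at
  the other end adds at most one.\<close>

lemma tconj_peak:
  assumes x: "glen (tconj T x w) < glen w" and y: "glen (tconj T y w) \<le> glen w"
  shows "x = y \<or> tconj T y w \<doteq> w \<or> (comm x y \<and> glen (tconj T y (tconj T x w)) < glen w)"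
proof (cases "x = y \<or> tconj T y w \<doteq> w")
  case False
  note x' = tconj_shorter[OF x]
  have "comm x y \<and> glen (tconj T y (tconj T x w)) < glen w"
    if "first_letter y w"
  proof -
    have ne: "x \<noteq> y" using False by simp
    note D = first_letter_pair[OF x'(1) that ne]
    let ?u = "letter_inv x # w"
    have Nu: "glen ?u + 1 = glen w"
      using x'(1) glen_Cons_cases[of "letter_inv x" w] by (auto simp: first_letter_def)
    have 1: "first_letter y ?u" using D(2) Nu by (simp add: first_letter_def)
    have 2: "last_letter (letter_inv (flip T x)) ?u"
      using Nu x'(3) by (simp add: last_letter_def tconj_def)
    have "y \<noteq> letter_inv (flip T x)" using comm_irrefl[OF D(1)] by auto
    with first_last_letter[OF 1 2] Nu have "glen (letter_inv y # tconj T x w) + 3 = glen w"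
      by (simp add: tconj_def)
    then show ?thesis using D(1) glen_snoc_cases[of "letter_inv y # tconj T x w" "flip T y"]
      by (auto simp: tconj_def)
  qed
  moreover have "comm x y \<and> glen (tconj T y (tconj T x w)) < glen w"
    if l: "last_letter (letter_inv (flip T y)) w"
  proof -
    have ne: "letter_inv (flip T x) \<noteq> letter_inv (flip T y)" using False by simp
    note D = last_letter_pair[OF x'(2) l ne]
    have c: "comm x y" using D(1) by simp
    let ?u = "w @ [flip T x]"
    have Nu: "glen ?u + 1 = glen w"
      using x'(2) glen_snoc_cases[of w "flip T x"] by (auto simp: last_letter_def)
    have 1: "first_letter x ?u" using Nu x'(3) by (simp add: first_letter_def tconj_def)
    have 2: "last_letter (letter_inv (flip T y)) ?u" using D(2) Nu by (simp add: last_letter_def)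
    have "x \<noteq> letter_inv (flip T y)" using comm_irrefl[OF c] by auto
    with first_last_letter[OF 1 2] Nu have "glen (tconj T x w @ [flip T y]) + 3 = glen w"
      by (simp add: tconj_def)
    then show ?thesis using c glen_Cons_cases[of "letter_inv y" "tconj T x w @ [flip T y]"]
      by (auto simp: tconj_def)
  qed
  ultimately show ?thesis using tconj_not_longer[OF y] False by blast
qed auto

text \<open>There is a path of one-letter twisted conjugations from \<open>a\<close> to \<open>n\<close> along which the length
  never increases.\<close>

inductive descends :: "'v set \<Rightarrow> 'v signed_word \<Rightarrow> 'v signed_word \<Rightarrow> bool" for T n where
  base: "a \<doteq> n \<Longrightarrow> descends T n a"
| step: "descends T n b \<Longrightarrow> tconj T x a \<doteq> b \<Longrightarrow> glen b \<le> glen a \<Longrightarrow> descends T n a"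

lemma descends_cong:
  assumes "descends T n a" "a' \<doteq> a"
  shows "descends T n a'"
  using assms
proof (cases rule: descends.cases)
  case base
  then show ?thesis using assms(2) by (auto intro: descends.base pres_cong.trans)
next
  case (step b x)
  then show ?thesis using assms(2)
    by (auto intro!: descends.step[of T n b x a'] intro: pres_cong.trans[OF tconj_cong] dest: glen_cong)
qed

lemma descends_glen: "descends T n a \<Longrightarrow> glen n \<le> glen a"
  by (induction rule: descends.induct) (auto dest: glen_cong)

text \<open>Closure of the descending elements under twisted conjugation by a letter: a step up is trivial,
  and a step down from \<open>a\<close> is pushed along the path from \<open>a\<close> to \<open>n\<close> by peak reduction. The outer
  induction is on the length of \<open>a\<close>, the inner one on the path, because the first step of the path may be level.
  The step down never reaches the end of the path, as \<open>n\<close> is irreducible.\<close>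

lemma descends_tconj:
  assumes irr: "\<And>x. glen n \<le> glen (tconj T x n)"
  shows "descends T n a \<Longrightarrow> descends T n (tconj T x a)"
proof (induction "glen a" arbitrary: a x rule: less_induct)
  case less
  show ?case
  proof (cases "glen a \<le> glen (tconj T x a)")
    case True
    then show ?thesis using less.prems tconj_inv[of T x a]
      by (auto intro!: descends.step[of T n a "letter_inv x"])
  next
    case False
    have outer: "descends T n (tconj T y c)" if "descends T n c" "glen c < glen a" for c y
      using less.hyps that by blast
    have "descends T n (tconj T x a)" if "glen (tconj T x a) < glen a"
      using \<open>descends T n a\<close> that outer
    proof (induction arbitrary: x rule: descends.induct)
      case (base a)
      have "glen (tconj T x n) < glen n"
        using base glen_cong[OF base(1)] glen_cong[OF tconj_cong[OF base(1), of T x]] by simp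
      with irr[of x] show ?case by simp
    next
      case (step b y a)
      have Ny: "glen (tconj T y a) = glen b" using step.hyps(2) by (rule glen_cong)
      then have "glen (tconj T y a) \<le> glen a" using step.hyps(3) by simp
      from tconj_peak[OF step.prems(1) this] show ?case
      proof (elim disjE conjE)
        assume "x = y"
        then show ?thesis using descends_cong[OF step.hyps(1,2)] by simp
      next
        assume "tconj T y a \<doteq> a"
        then have ab: "a \<doteq> b" using step.hyps(2) by (meson pres_cong.sym pres_cong.trans)
        have cab: "tconj T x a \<doteq> tconj T x b" by (rule tconj_cong[OF ab])
        have "descends T n (tconj T x b)"
          using step.IH[of x] step.prems glen_cong[OF ab] glen_cong[OF cab] by simp
        then show ?thesis using cab by (rule descends_cong)
      next
        assume c: "comm x y" and less: "glen (tconj T y (tconj T x a)) < glen a"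
        let ?d = "tconj T x b"
        have d: "?d \<doteq> tconj T y (tconj T x a)"
          using tconj_cong[OF step.hyps(2), of T x] tconj_commute[OF c, of T a]
          by (meson pres_cong.sym pres_cong.trans)
        have Nd: "glen ?d < glen a" using glen_cong[OF d] less by simp
        have "descends T n ?d"
        proof (cases "glen b < glen a")
          case True
          then show ?thesis using step.prems(2) step.hyps(1) by blast
        next
          case False
          with step.hyps(3) have "glen b = glen a" by simp
          then show ?thesis using step.IH[of x] step.prems Nd by simp
        qed
        then have "descends T n (tconj T (letter_inv y) ?d)" using step.prems(2) Nd by blast
        moreover have "tconj T x a \<doteq> tconj T (letter_inv y) ?d"
          using tconj_cong[OF d, of T "letter_inv y"] tconj_inv[of T y "tconj T x a"]
          by (meson pres_cong.sym pres_cong.trans)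
        ultimately show ?thesis by (rule descends_cong)
      qed
    qed
    then show ?thesis using False by simp
  qed
qed

lemma twisted_conjugacy_minimal:
  assumes irr: "\<And>x. glen n \<le> glen (tconj T x n)"
  shows "glen n \<le> glen (inv_word g @ n @ map (flip T) g)"
proof (rule descends_glen[of T])
  show "descends T n (inv_word g @ n @ map (flip T) g)"
  proof (induction g rule: rev_induct)
    case Nil
    show ?case by (simp add: descends.base)
  next
    case (snoc x g)
    from descends_tconj[OF irr this, of x] show ?case by (simp add: tconj_def)
  qed
qed

section \<open>Appending a letter to a geodesic\<close>

text \<open>The letters that become first letters when they are appended to \<open>w\<close>.\<close>

definition central_letter :: "'v \<times> bool \<Rightarrow> 'v signed_word \<Rightarrow> bool" where
  "central_letter a w \<longleftrightarrow> a # w \<doteq> w @ [a] \<and> glen w < glen (a # w)"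

definition removable_pair :: "'v \<times> bool \<Rightarrow> 'v \<times> bool \<Rightarrow> 'v signed_word \<Rightarrow> bool" where
  "removable_pair a c w \<longleftrightarrow> glen (letter_inv a # w @ [c]) < glen w"

lemma glen_snoc_longer_iff: "glen w < glen (w @ [b]) \<longleftrightarrow> \<not> last_letter (letter_inv b) w"
  using glen_snoc_cases[of w b] by (auto simp: last_letter_def)

lemma glen_snoc_cancel [simp]: "glen (w @ [b, letter_inv b]) = glen w"
  using glen_cong[OF cong_cancel_mid[of w b "[]"]] by simp

lemma glen_Cons_snoc_cancel [simp]: "glen (a # w @ [b, letter_inv b]) = glen (a # w)"
  using glen_snoc_cancel[of "a # w" b] by simp

lemma cong_cancel_right:
  assumes "u @ [a] \<doteq> v @ [a]"
  shows "u \<doteq> v"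
proof -
  have "(u @ [a]) @ [letter_inv a] \<doteq> (v @ [a]) @ [letter_inv a]"
    by (intro cong_append cong_refl assms)
  then show ?thesis using cong_cancel_mid[of u a "[]"] cong_cancel_mid[of v a "[]"]
    by simp (meson pres_cong.sym pres_cong.trans)
qed

context
  fixes w :: "'v signed_word" and b :: "'v \<times> bool"
  assumes longer: "glen w < glen (w @ [b])"
begin

lemma glen_longer: "glen (w @ [b]) = Suc (glen w)"
  using longer glen_snoc_cases[of w b] by auto

lemma last_letter_snoc_self: "last_letter b (w @ [b])"
  using longer by (simp add: last_letter_def)

lemma last_letter_snoc:
  "last_letter a (w @ [b]) \<longleftrightarrow> a = b \<or> comm a b \<and> last_letter a w"
proof
  assume a: "last_letter a (w @ [b])"
  show "a = b \<or> comm a b \<and> last_letter a w"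
  proof (cases "a = b")
    case False
    note D = last_letter_pair[OF last_letter_snoc_self a]
    have "glen (w @ [b, letter_inv b, letter_inv a]) = glen (w @ [letter_inv a])"
      by (rule glen_cong) (use cong_cancel_mid[of w b "[letter_inv a]"] in simp)
    with D False glen_longer show ?thesis by (simp add: last_letter_def comm_sym)
  qed simp
next
  assume "a = b \<or> comm a b \<and> last_letter a w"
  then show "last_letter a (w @ [b])"
  proof (elim disjE conjE)
    assume c: "comm a b" and l: "last_letter a w"
    have "glen (w @ [b, letter_inv a]) = glen (w @ [letter_inv a, b])"
      using c by (intro glen_cong cong_swap_mid) (simp add: comm_sym)
    then show ?thesis
      using l glen_longer glen_snoc_cases[of "w @ [letter_inv a]" b] by (auto simp: last_letter_def)
  qed (simp add: last_letter_snoc_self)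
qed

lemma first_letter_snoc:
  "first_letter a (w @ [b]) \<longleftrightarrow> first_letter a w \<or> a = b \<and> central_letter a w"
proof
  assume "first_letter a (w @ [b])"
  from first_last_letter[OF this last_letter_snoc_self]
  show "first_letter a w \<or> a = b \<and> central_letter a w"
  proof (elim disjE conjE)
    assume "glen (letter_inv a # (w @ [b]) @ [letter_inv b]) + 2 = glen (w @ [b])"
    then show ?thesis using glen_longer by (simp add: first_letter_def)
  next
    assume ab: "a = b" and "a # (w @ [b]) @ [letter_inv a] \<doteq> w @ [b]"
    then have "a # w \<doteq> w @ [a]"
      using cong_cancel_mid[of "a # w" b "[]"] by simp (meson pres_cong.sym pres_cong.trans)
    then show ?thesis using ab longer by (auto simp: central_letter_def dest: glen_cong)
  qed
next
  assume "first_letter a w \<or> a = b \<and> central_letter a w"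
  then show "first_letter a (w @ [b])"
  proof (elim disjE conjE)
    assume "first_letter a w"
    then show ?thesis using glen_longer glen_snoc_cases[of "letter_inv a # w" b]
      by (auto simp: first_letter_def)
  next
    assume ab: "a = b" and "central_letter a w"
    then have "letter_inv b # b # w \<doteq> letter_inv b # w @ [b]"
      by (intro cong_Cons) (auto simp: central_letter_def)
    from glen_cong[OF this] glen_cong[OF cong_cancel_mid'[of "[]" b w]] ab longer show ?thesis
      by (simp add: first_letter_def)
  qed
qed

lemma central_letter_snoc:
  "central_letter a (w @ [b]) \<longleftrightarrow> central_letter a w \<and> (a = b \<or> comm a b)"
proof
  assume "central_letter a (w @ [b])"
  then have eq: "a # w @ [b] \<doteq> w @ [b, a]" and N: "glen (w @ [b]) < glen (a # w @ [b])"
    by (auto simp: central_letter_def)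
  have Nw: "glen w < glen (a # w)" "glen (a # w) < glen (a # w @ [b])"
    using N glen_longer glen_Cons_cases[of a w] glen_snoc_cases[of "a # w" b, simplified] by arith+
  show "central_letter a w \<and> (a = b \<or> comm a b)"
  proof (cases "a = b")
    case True
    then have "a # w \<doteq> w @ [b]" using cong_cancel_right[of "a # w" b "w @ [b]"] eq by simp
    then show ?thesis using True Nw by (simp add: central_letter_def)
  next
    case False
    have 1: "last_letter b (a # w @ [b])" using Nw by (simp add: last_letter_def)
    have "a # w @ [b, letter_inv a] \<doteq> w @ [b, a, letter_inv a]"
      using cong_append[OF eq cong_refl[of "[letter_inv a]"]] by simp
    moreover have "w @ [b, a, letter_inv a] \<doteq> w @ [b]"
      using cong_cancel_mid[of "w @ [b]" a "[]"] by simp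
    ultimately have "glen (a # w @ [b, letter_inv a]) = glen (w @ [b])"
      by (metis glen_cong)
    then have 2: "last_letter a (a # w @ [b])" using N by (simp add: last_letter_def)
    have c: "comm a b" using last_letter_pair(1)[OF 2 1 False] .
    have "(a # w) @ [b] \<doteq> (w @ [a]) @ [b]"
      using eq cong_swap_mid[of b a w "[]"] c by (auto simp: comm_sym intro: pres_cong.trans)
    then have "a # w \<doteq> w @ [a]" by (rule cong_cancel_right)
    then show ?thesis using c Nw by (simp add: central_letter_def)
  qed
next
  assume *: "central_letter a w \<and> (a = b \<or> comm a b)"
  then have eq: "a # w \<doteq> w @ [a]" and N: "glen w < glen (a # w)" by (auto simp: central_letter_def)
  have "a # w @ [b] \<doteq> w @ [a, b]"
    using cong_append[OF eq cong_refl[of "[b]"]] by simp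
  moreover have "w @ [a, b] \<doteq> w @ [b, a]"
    using * cong_swap_mid[of a b w "[]"] by auto
  ultimately have "a # w @ [b] \<doteq> w @ [b, a]" by (rule pres_cong.trans)
  moreover have "glen (w @ [b]) < glen (a # w @ [b])"
  proof (rule ccontr)
    assume "\<not> ?thesis"
    then have "first_letter (letter_inv a) (w @ [b])"
      using glen_Cons_cases[of a "w @ [b]"] by (simp add: first_letter_def)
    moreover have "\<not> first_letter (letter_inv a) w" using N by (simp add: first_letter_def)
    moreover have "letter_inv a \<noteq> b" using * comm_irrefl[of a b] by auto
    ultimately show False by (simp add: first_letter_snoc)
  qed
  ultimately show "central_letter a (w @ [b])" by (simp add: central_letter_def)
qed

text \<open>The condition \<open>fst c = fst a\<close> cannot be dropped: for \<open>w = c\<^sup>-\<^sup>1\<close> and \<open>a = b\<close> commuting with \<open>c\<close>,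
  the letters \<open>a\<close> and \<open>c\<close> erase \<open>w b\<close>, although \<open>a\<close> does not occur in \<open>w\<close>. With
  it, \<open>c\<close> cannot commute with \<open>b\<close> if \<open>a = b\<close>, so that \<open>a\<close> is a first letter of \<open>w\<close> already.\<close>

lemma removable_pair_snoc:
  assumes ca: "fst c = fst a"
  shows "removable_pair a c (w @ [b]) \<longleftrightarrow>
    c = letter_inv b \<and> first_letter a w \<or> comm c b \<and> removable_pair a c w"
proof (cases "c = letter_inv b")
  case True
  then show ?thesis
    using glen_longer glen_Cons_cases[of "letter_inv a" w]
    by (auto simp: removable_pair_def first_letter_def)
next
  case cb: False
  have swap: "glen (p @ [c, b]) = glen (p @ [b, c])" if "comm c b" for p
    using cong_swap_mid[OF that, of p "[]"] by (simp add: glen_cong)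
  show ?thesis
  proof
    assume "removable_pair a c (w @ [b])"
    then have rp: "glen (letter_inv a # w @ [b, c]) + 1 = glen w"
      and f: "first_letter a (w @ [b])" and l: "last_letter (letter_inv c) (w @ [b])"
      using glen_longer glen_Cons_cases[of "letter_inv a" "w @ [b]"] glen_Cons_cases[of "letter_inv a" "w @ [b, c]"]
        glen_snoc_cases[of "w @ [b]" c] glen_snoc_cases[of "letter_inv a # w @ [b]" c]
      by (auto simp: removable_pair_def first_letter_def last_letter_def)
    from l cb have cc: "comm c b" and lw: "last_letter (letter_inv c) w"
      by (auto simp: last_letter_snoc letter_inv_eq_commute)
    have "a \<noteq> b" using comm_irrefl[OF cc] ca by auto
    with f have fw: "first_letter a w" by (simp add: first_letter_snoc)
    have "removable_pair a c w"
    proof (rule ccontr)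
      let ?v = "letter_inv a # w @ [c]"
      assume "\<not> removable_pair a c w"
      then have Nv: "glen ?v = glen w" "glen (letter_inv a # w) + 1 = glen w"
        using fw glen_Cons_cases[of "letter_inv a" w] glen_snoc_cases[of "letter_inv a # w" c]
        by (auto simp: removable_pair_def first_letter_def)
      have 1: "last_letter c ?v" using Nv by (simp add: last_letter_def)
      have 2: "last_letter (letter_inv b) ?v"
        using rp Nv swap[OF cc, of "letter_inv a # w"] by (simp add: last_letter_def)
      from last_letter_pair(2)[OF 1 2 cb]
      have "glen (letter_inv a # w @ [c, letter_inv c, b]) + 2 = glen w" using Nv by simp
      moreover have "glen (letter_inv a # w @ [c, letter_inv c, b]) = glen (letter_inv a # w @ [b])"
        using glen_cong[OF cong_cancel_mid[of "letter_inv a # w" c "[b]"]] by simp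
      ultimately show False
        using glen_longer glen_Cons_cases[of "letter_inv a" "w @ [b]"] by auto
    qed
    then show "c = letter_inv b \<and> first_letter a w \<or> comm c b \<and> removable_pair a c w"
      using cc by simp
  next
    assume "c = letter_inv b \<and> first_letter a w \<or> comm c b \<and> removable_pair a c w"
    with cb have cc: "comm c b" and rp: "removable_pair a c w" by auto
    have "glen (letter_inv a # w @ [c, b]) \<le> glen w"
      using rp glen_snoc_cases[of "letter_inv a # w @ [c]" b] by (auto simp: removable_pair_def)
    then show "removable_pair a c (w @ [b])"
      using glen_longer swap[OF cc, of "letter_inv a # w"] by (simp add: removable_pair_def)
  qed
qed

end

end

section \<open>Regular languages and right congruences\<close>

text \<open>The easy half of the Myhill--Nerode theorem, with the congruence given as the kernel of \<open>f\<close>. The automaton has the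
  values of \<open>f\<close>, numbered by \<open>e\<close>, as states, and it computes transitions on representatives.\<close>

lemma regular_language_right_congruence:
  fixes f :: "'a list \<Rightarrow> 's"
  assumes fin: "finite \<Sigma>" "finite (f ` lists \<Sigma>)" and L: "L \<subseteq> lists \<Sigma>"
    and step: "\<And>u v a. u \<in> lists \<Sigma> \<Longrightarrow> v \<in> lists \<Sigma> \<Longrightarrow> a \<in> \<Sigma> \<Longrightarrow> f u = f v \<Longrightarrow> f (u @ [a]) = f (v @ [a])"
    and sat: "\<And>u v. u \<in> lists \<Sigma> \<Longrightarrow> v \<in> lists \<Sigma> \<Longrightarrow> f u = f v \<Longrightarrow> u \<in> L \<Longrightarrow> v \<in> L"
  shows "regular_language \<Sigma> L"
proof -
  obtain e :: "'s \<Rightarrow> nat" where e: "inj_on e (f ` lists \<Sigma>)"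
    using finite_imp_inj_to_nat_seg[OF fin(2)] by blast
  define g where "g w = e (f w)" for w
  define r where "r q = (SOME w. w \<in> lists \<Sigma> \<and> g w = q)" for q
  define \<delta> where "\<delta> q a = g (r q @ [a])" for q a
  have g_eq: "f u = f v" if "g u = g v" "u \<in> lists \<Sigma>" "v \<in> lists \<Sigma>" for u v
    using e that by (auto simp: g_def inj_on_def)
  have r: "r (g w) \<in> lists \<Sigma> \<and> f (r (g w)) = f w" if w: "w \<in> lists \<Sigma>" for w
    using someI[of "\<lambda>u. u \<in> lists \<Sigma> \<and> g u = g w" w] w g_eq unfolding r_def by blast
  have \<delta>: "\<delta> (g w) a = g (w @ [a])" if "w \<in> lists \<Sigma>" "a \<in> \<Sigma>" for w a
    using step[OF _ that(1,2)] r[OF that(1)] unfolding \<delta>_def g_def by auto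
  have run: "foldl \<delta> (g []) w = g w" if "w \<in> lists \<Sigma>" for w
    using that by (induction w rule: rev_induct) (auto simp: \<delta>)
  show ?thesis unfolding regular_language_def
  proof (intro conjI exI)
    show "finite (g ` lists \<Sigma>)" using fin(2) by (simp add: g_def image_image[of e f, symmetric])
    show "g [] \<in> g ` lists \<Sigma>" by blast
    show "g ` L \<subseteq> g ` lists \<Sigma>" using L by blast
    show "\<forall>q\<in>g ` lists \<Sigma>. \<forall>a\<in>\<Sigma>. \<delta> q a \<in> g ` lists \<Sigma>"
      by (auto simp: \<delta> simp del: in_lists_conv_set intro!: imageI)
    show "L = {w \<in> lists \<Sigma>. foldl \<delta> (g []) w \<in> g ` L}"
    proof (intro equalityI subsetI)
      fix w assume "w \<in> L"
      moreover from this have "w \<in> lists \<Sigma>" using L by blast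
      ultimately show "w \<in> {w \<in> lists \<Sigma>. foldl \<delta> (g []) w \<in> g ` L}" using run by simp
    next
      fix w assume "w \<in> {w \<in> lists \<Sigma>. foldl \<delta> (g []) w \<in> g ` L}"
      then have w: "w \<in> lists \<Sigma>" and "foldl \<delta> (g []) w \<in> g ` L" by simp_all
      then obtain u where "u \<in> L" "g w = g u" unfolding run[OF w] by blast
      then show "w \<in> L" using sat[of u w] g_eq[of u w] L w by auto
    qed
  qed (rule fin(1))
qed

section \<open>A finite profile deciding twisted minimality\<close>

context loopfree_graph
begin

text \<open>Flipping signs preserves commutation and cancellation, hence normal forms and lengths.\<close>

lemma pull_map_flip: "pull (flip T a) (map (flip T) w) = map_option (map (flip T)) (pull a w)"
  by (induction w) (auto simp: option.map_comp o_def)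

lemma nf_map_flip: "nf (map (flip T) w) = map (flip T) (nf w)"
proof (induction w)
  case (Cons a w)
  then show ?case using pull_map_flip[of T "letter_inv a" "nf w"]
    by (auto simp: nf_Cons lmult_def split: option.split)
qed (simp add: nf_def)

lemma glen_map_flip [simp]: "glen (map (flip T) w) = glen w"
  by (simp add: glen_def nf_map_flip)

lemma first_letter_in:
  assumes "first_letter a w" "w \<in> lists (S \<times> UNIV)"
  shows "a \<in> S \<times> UNIV"
proof -
  obtain v where "pull a (nf w) = Some v"
    using assms(1) by (auto simp: first_letter_def shorter_iff_pull)
  from pull_pres_cong[OF this] pres_cong_lists[OF nf_pres_cong[OF assms(2)]] show ?thesis by auto
qed

text \<open>The competitors \<open>g\<close> range over the vertices in \<open>S\<close> only, while \<open>twisted_conjugacy_minimal\<close>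
  asks for all letters; a letter that shortens \<open>w\<close> occurs in its normal form, so it belongs to \<open>S\<close>.\<close>

lemma twisted_minimal_iff:
  assumes w: "w \<in> lists (S \<times> UNIV)"
  shows "(\<forall>g\<in>lists (S \<times> UNIV). length w \<le> glen (inv_word g @ w @ map (flip T) g)) \<longleftrightarrow>
    glen w = length w \<and> (\<forall>a\<in>S \<times> UNIV. \<not> removable_pair a (flip T a) w)"
proof
  assume *: "\<forall>g\<in>lists (S \<times> UNIV). length w \<le> glen (inv_word g @ w @ map (flip T) g)"
  from bspec[OF *, of "[]"] have geo: "glen w = length w"
    using glen_le_length[of w] by simp
  moreover have "\<not> removable_pair a (flip T a) w" if "a \<in> S \<times> UNIV" for a
    using bspec[OF *, of "[a]"] that geo by (simp add: removable_pair_def)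
  ultimately show "glen w = length w \<and> (\<forall>a\<in>S \<times> UNIV. \<not> removable_pair a (flip T a) w)" by blast
next
  assume *: "glen w = length w \<and> (\<forall>a\<in>S \<times> UNIV. \<not> removable_pair a (flip T a) w)"
  have "glen w \<le> glen (tconj T a w)" for a
  proof (rule ccontr)
    assume "\<not> ?thesis"
    then have "glen (tconj T a w) < glen w" by simp
    moreover have "a \<in> S \<times> UNIV"
      by (rule first_letter_in[OF tconj_shorter(1)[OF \<open>glen (tconj T a w) < glen w\<close>] w])
    ultimately show False using * unfolding removable_pair_def tconj_def by blast
  qed
  from twisted_conjugacy_minimal[OF this] *
  show "\<forall>g\<in>lists (S \<times> UNIV). length w \<le> glen (inv_word g @ w @ map (flip T) g)" by simp
qed

text \<open>A word that is not geodesic has no geodesic extension, so all such words may share one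
  value.\<close>

definition profile ::
  "'v set \<Rightarrow> 'v signed_word \<Rightarrow> (('v \<times> bool) set \<times> ('v \<times> bool) set \<times> ('v \<times> bool) set
    \<times> (('v \<times> bool) \<times> ('v \<times> bool)) set) option" where
  "profile S w = (if glen w = length w
    then Some ({a \<in> S \<times> UNIV. first_letter a w}, {a \<in> S \<times> UNIV. last_letter a w},
      {a \<in> S \<times> UNIV. central_letter a w},
      {(a, c). a \<in> S \<times> UNIV \<and> c \<in> S \<times> UNIV \<and> fst c = fst a \<and> removable_pair a c w})
    else None)"

lemma finite_range_profile:
  assumes "finite S"
  shows "finite (range (profile S))"
proof (rule finite_subset)
  let ?X = "S \<times> (UNIV :: bool set)"
  show "range (profile S) \<subseteq>
      insert None (Some ` (Pow ?X \<times> Pow ?X \<times> Pow ?X \<times> Pow (?X \<times> ?X)))"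
    by (auto simp: profile_def)
  show "finite (insert None (Some ` (Pow ?X \<times> Pow ?X \<times> Pow ?X \<times> Pow (?X \<times> ?X))))"
    using assms by simp
qed

lemma geodesic_snoc_iff:
  "glen (w @ [b]) = length (w @ [b]) \<longleftrightarrow> glen w = length w \<and> glen w < glen (w @ [b])"
  using glen_snoc_cases[of w b] glen_le_length[of w] by auto

lemma profile_removable_pair:
  assumes "profile S u = profile S v" "glen u = length u" "glen v = length v"
    and "a \<in> S \<times> UNIV" "c \<in> S \<times> UNIV" "fst c = fst a"
  shows "removable_pair a c u \<longleftrightarrow> removable_pair a c v"
proof -
  have "{(a, c). a \<in> S \<times> UNIV \<and> c \<in> S \<times> UNIV \<and> fst c = fst a \<and> removable_pair a c u} =
      {(a, c). a \<in> S \<times> UNIV \<and> c \<in> S \<times> UNIV \<and> fst c = fst a \<and> removable_pair a c v}"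
    using assms(1-3) by (simp add: profile_def)
  from arg_cong[OF this, of "\<lambda>A. (a, c) \<in> A"] assms(4-6) show ?thesis by simp
qed

lemma profile_snoc:
  assumes b: "b \<in> S \<times> UNIV" and eq: "profile S u = profile S v"
  shows "profile S (u @ [b]) = profile S (v @ [b])"
proof (cases "glen u = length u")
  case False
  with eq have "glen v \<noteq> length v" by (auto simp: profile_def split: if_splits)
  with False show ?thesis unfolding profile_def geodesic_snoc_iff by simp
next
  case u: True
  with eq have v: "glen v = length v" by (auto simp: profile_def split: if_splits)
  from eq u v
  have F: "first_letter a u \<longleftrightarrow> first_letter a v" and R: "last_letter a u \<longleftrightarrow> last_letter a v"
    and K: "central_letter a u \<longleftrightarrow> central_letter a v" if "a \<in> S \<times> UNIV" for a
    using that by (auto simp: profile_def set_eq_iff)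
  have C: "removable_pair a c u \<longleftrightarrow> removable_pair a c v"
    if "a \<in> S \<times> UNIV" "c \<in> S \<times> UNIV" "fst c = fst a" for a c
    by (rule profile_removable_pair[OF eq u v that])
  have "letter_inv b \<in> S \<times> UNIV" using b by (auto simp: letter_inv_def)
  from R[OF this] have l: "glen u < glen (u @ [b]) \<longleftrightarrow> glen v < glen (v @ [b])"
    by (simp add: glen_snoc_longer_iff)
  show ?thesis
  proof (cases "glen u < glen (u @ [b])")
    case False
    with l show ?thesis unfolding profile_def geodesic_snoc_iff by simp
  next
    case True
    with l have lu: "glen u < glen (u @ [b])" and lv: "glen v < glen (v @ [b])" by auto
    have "first_letter a (u @ [b]) \<longleftrightarrow> first_letter a (v @ [b])"
      "last_letter a (u @ [b]) \<longleftrightarrow> last_letter a (v @ [b])"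
      "central_letter a (u @ [b]) \<longleftrightarrow> central_letter a (v @ [b])" if "a \<in> S \<times> UNIV" for a
      using F[OF that] R[OF that] K[OF that]
      by (simp_all add: first_letter_snoc last_letter_snoc central_letter_snoc lu lv)
    moreover have "removable_pair a c (u @ [b]) \<longleftrightarrow> removable_pair a c (v @ [b])"
      if "a \<in> S \<times> UNIV" "c \<in> S \<times> UNIV" "fst c = fst a" for a c
      using C[OF that] F[OF that(1)] by (simp add: removable_pair_snoc[OF _ that(3)] lu lv)
    ultimately show ?thesis using u v lu lv unfolding profile_def geodesic_snoc_iff
      by (auto simp del: mem_Times_iff)
  qed
qed

lemma profile_eq_minimal:
  assumes "profile S u = profile S v"
  shows "glen u = length u \<and> (\<forall>a\<in>S \<times> UNIV. \<not> removable_pair a (flip T a) u) \<longleftrightarrow>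
    glen v = length v \<and> (\<forall>a\<in>S \<times> UNIV. \<not> removable_pair a (flip T a) v)"
proof -
  have *: "flip T a \<in> S \<times> UNIV" if "a \<in> S \<times> UNIV" for a
    using that by (auto simp: flip_def)
  have "removable_pair a (flip T a) u \<longleftrightarrow> removable_pair a (flip T a) v"
    if "a \<in> S \<times> UNIV" "glen u = length u" "glen v = length v" for a
    by (rule profile_removable_pair[OF assms that(2,3,1) *[OF that(1)]]) simp
  moreover have "glen u = length u \<longleftrightarrow> glen v = length v"
    using assms by (auto simp: profile_def split: if_splits)
  ultimately show ?thesis by blast
qed

end

section \<open>Conjugacy geodesics in the extension\<close>

lemma inv_raag_gen:
  assumes "x \<in> V"
  shows "inv\<^bsub>raag V E\<^esub> raag_gen V E x = pres_cong V (raag_rels E) `` {[(x, False)]}"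
proof (rule group.inv_equality[OF group_raag])
  have l: "[(x, c)] \<in> lists (V \<times> UNIV)" for c using assms by simp
  show "pres_cong V (raag_rels E) `` {[(x, False)]} \<otimes>\<^bsub>raag V E\<^esub> raag_gen V E x = \<one>\<^bsub>raag V E\<^esub>"
    using presented_mult_class[OF l[of False] l[of True], of "raag_rels E"]
      equiv_class_eq[OF equiv_pres_cong pres_cong.cancel[OF assms, of False]]
    by (simp add: raag_def raag_gen_def presented_group_def)
  show "pres_cong V (raag_rels E) `` {[(x, False)]} \<in> carrier (raag V E)"
    unfolding raag_def by (rule presented_class_carrier[OF l])
qed (rule raag_gen_carrier[OF assms])

lemma raag_gens_eq:
  "raag_gens V E = (\<lambda>b. pres_cong V (raag_rels E) `` {[b]}) ` (V \<times> UNIV)"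
proof
  show "raag_gens V E \<subseteq> (\<lambda>b. pres_cong V (raag_rels E) `` {[b]}) ` (V \<times> UNIV)"
    by (auto simp: raag_gens_def inv_raag_gen) (auto simp: raag_gen_def)
qed (auto intro: raag_letter_gens)

lemma map_flip_lists: "w \<in> lists (V \<times> UNIV) \<Longrightarrow> map (flip T) w \<in> lists (V \<times> UNIV)"
  by (induction w) (auto simp: flip_def)

text \<open>The automorphism enters only through the set \<open>T\<close> of vertices that it inverts.\<close>

locale inverting_extension =
  fixes V :: "'v set" and E :: "'v set set"
    and \<phi> :: "'v signed_word set \<Rightarrow> 'v signed_word set" and m :: nat and T :: "'v set"
  assumes graph: "finite_simple_graph V E"
    and aut: "\<phi> \<in> carrier (AutoGroup (raag V E))"
    and pos: "m > 0"
    and pow: "\<phi> [^]\<^bsub>AutoGroup (raag V E)\<^esub> m = \<one>\<^bsub>AutoGroup (raag V E)\<^esub>"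
    and flips: "\<And>w. w \<in> lists (V \<times> UNIV) \<Longrightarrow>
      \<phi> (pres_cong V (raag_rels E) `` {w}) = pres_cong V (raag_rels E) `` {map (flip T) w}"

sublocale inverting_extension \<subseteq> loopfree_graph E
  using graph by unfold_locales (auto simp: finite_simple_graph_def doubleton_eq_iff)

context inverting_extension
begin

abbreviation "A \<equiv> raag V E"
abbreviation "G \<equiv> cyclic_extension A \<phi> m"
abbreviation "\<Sigma> \<equiv> ext_raag_gens V E \<phi> m"
abbreviation "letters \<equiv> V \<times> (UNIV :: bool set)"
abbreviation "cls w \<equiv> pres_cong V (raag_rels E) `` {w}"

lemma grp: "group G"
  by (rule group_cyclic_extension[OF group_raag aut pow])

lemma cls_eq_iff: "u \<in> lists letters \<Longrightarrow> v \<in> lists letters \<Longrightarrow> cls u = cls v \<longleftrightarrow> (u, v) \<in> pres_cong V (raag_rels E)"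
  by (rule eq_equiv_class_iff[OF equiv_pres_cong])

lemma cls_mult: "u \<in> lists letters \<Longrightarrow> v \<in> lists letters \<Longrightarrow> cls u \<otimes>\<^bsub>A\<^esub> cls v = cls (u @ v)"
  unfolding raag_def by (rule presented_mult_class)

lemma cls_one: "\<one>\<^bsub>A\<^esub> = cls []"
  by (simp add: raag_def presented_group_def)

lemma cls_carrier: "w \<in> lists letters \<Longrightarrow> cls w \<in> carrier A"
  unfolding raag_def by (rule presented_class_carrier)

lemma cls_cases:
  assumes "g \<in> carrier A"
  obtains w where "w \<in> lists letters" "g = cls w"
  using assms unfolding raag_def by (rule presented_carrierE)

lemma cls_glen: "u \<in> lists letters \<Longrightarrow> v \<in> lists letters \<Longrightarrow> cls u = cls v \<Longrightarrow> glen u = glen v"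
  using cls_eq_iff pres_cong_glen by blast

definition twist :: "int \<Rightarrow> 'v set" where
  "twist k = (if even k then {} else T)"

text \<open>Flipping signs twice does nothing. The exponent of \<open>\<phi>\<close> therefore only matters modulo two, whatever
  the value of \<open>m\<close> is.\<close>

lemma phi_square: "\<phi> \<otimes>\<^bsub>AutoGroup A\<^esub> \<phi> = \<one>\<^bsub>AutoGroup A\<^esub>"
proof -
  interpret AA: group "AutoGroup A" by (rule group.AutoGroup[OF group_raag])
  have ext: "f \<in> extensional (carrier A)" if "f \<in> carrier (AutoGroup A)" for f
    using that by (simp add: AutoGroup_def auto_def Bij_def BijGroup_def)
  show ?thesis
  proof (rule extensionalityI[OF ext ext])
    fix g assume g: "g \<in> carrier A"
    then obtain w where w: "w \<in> lists letters" "g = cls w" by (rule cls_cases)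
    have "\<phi> (\<phi> g) = g"
      unfolding w(2) flips[OF w(1)] flips[OF map_flip_lists[OF w(1)]] by (simp add: o_def)
    then show "(\<phi> \<otimes>\<^bsub>AutoGroup A\<^esub> \<phi>) g = \<one>\<^bsub>AutoGroup A\<^esub> g"
      using g aut by (simp add: AutoGroup_mult_apply AutoGroup_one_apply)
  qed (use aut in simp_all)
qed

lemma action_cls:
  assumes "w \<in> lists letters"
  shows "(\<phi> [^]\<^bsub>AutoGroup A\<^esub> (- k :: int)) (cls w) = cls (map (flip (twist k)) w)"
proof -
  interpret AA: group "AutoGroup A" by (rule group.AutoGroup[OF group_raag])
  have "\<phi> [^]\<^bsub>AutoGroup A\<^esub> (2::nat) = \<one>\<^bsub>AutoGroup A\<^esub>"
    using phi_square aut by (simp add: numeral_2_eq_2)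
  from int_pow_mod_eq[OF AA.group_axioms aut this, of "- k"]
  have *: "\<phi> [^]\<^bsub>AutoGroup A\<^esub> (- k) = \<phi> [^]\<^bsub>AutoGroup A\<^esub> (- k mod 2)" by simp
  show ?thesis
  proof (cases "even k")
    case True
    then have "- k mod 2 = 0" by presburger
    with * True assms show ?thesis
      by (simp add: AutoGroup_one_apply cls_carrier twist_def)
  next
    case False
    then have "- k mod 2 = 1" by presburger
    with * False assms aut show ?thesis by (simp add: flips twist_def)
  qed
qed

lemma carrier_G: "carrier G = carrier A \<times> {0..<int m}"
  using pos by (simp add: cyclic_extension_def semidirect_product_def carrier_integer_mod_group)

lemma carrier_G_cases:
  assumes "K \<in> carrier G"
  obtains g j where "K = (cls g, j)" "g \<in> lists letters" "j \<in> {0..<int m}"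
proof -
  obtain x j where xj: "K = (x, j)" "x \<in> carrier A" "j \<in> {0..<int m}"
    using assms unfolding carrier_G by (rule SigmaE)
  from xj(2) obtain g where "g \<in> lists letters" "x = cls g" by (rule cls_cases)
  with xj that show thesis by blast
qed

lemma mult_G:
  assumes "u \<in> lists letters" "v \<in> lists letters"
  shows "(cls u, h) \<otimes>\<^bsub>G\<^esub> (cls v, k) = (cls (u @ map (flip (twist h)) v), (h + k) mod int m)"
  using assms by (simp add: cyclic_extension_def semidirect_product_def action_cls cls_mult map_flip_lists)

lemma one_G: "\<one>\<^bsub>G\<^esub> = (cls [], 0)"
  by (simp add: cyclic_extension_def semidirect_product_def cls_one)

lemma ext_t_eq: "ext_t A m = (cls [], 1 mod int m)"
  by (simp add: ext_t_def cls_one)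

lemma inv_ext_t_eq: "inv\<^bsub>G\<^esub> ext_t A m = (cls [], (- 1) mod int m)"
proof (rule group.inv_equality[OF grp])
  show "(cls [], (- 1) mod int m) \<otimes>\<^bsub>G\<^esub> ext_t A m = \<one>\<^bsub>G\<^esub>"
    by (simp add: ext_t_eq mult_G one_G mod_simps)
qed (use pos in \<open>simp_all add: ext_t_eq carrier_G cls_carrier\<close>)

definition T_letters :: "('v signed_word set \<times> int) set" where
  "T_letters = {(cls [], 1 mod int m), (cls [], (- 1) mod int m)}"

lemma Sigma_eq: "\<Sigma> = (\<lambda>b. (cls [b], 0)) ` letters \<union> T_letters"
  unfolding ext_raag_gens_def raag_gens_eq T_letters_def ext_t_eq[symmetric] inv_ext_t_eq[symmetric]
  by (auto simp: ext_embed_def image_iff)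

text \<open>This separates the letters of the Artin group from \<open>t\<^sup>\<plusminus>\<^sup>1\<close> even for \<open>m = 1\<close>, when
  \<open>t\<close> is the identity.\<close>

lemma letter_nontrivial: "b \<in> letters \<Longrightarrow> cls [b] \<noteq> cls []"
  using cls_glen[of "[b]" "[]"] by (auto simp: glen_def nf_Cons lmult_def nf_def)

text \<open>Any \<open>b\<close> with the right class serves, since only classes are multiplied.\<close>

definition decode :: "'v signed_word set \<times> int \<Rightarrow> 'v \<times> bool" where
  "decode a = (SOME b. b \<in> letters \<and> cls [b] = fst a)"

lemma letter_cases:
  assumes "a \<in> \<Sigma>"
  obtains "fst a = cls []" "a = (cls [], snd a)" "a \<in> T_letters"
  | "fst a \<noteq> cls []" "decode a \<in> letters" "a = (cls [decode a], 0)" "a \<notin> T_letters"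
proof (cases "a \<in> T_letters")
  case True
  then have "fst a = cls []" by (auto simp: T_letters_def)
  then show ?thesis using that(1) True by (metis prod.collapse)
next
  case False
  with assms have "a \<in> (\<lambda>b. (cls [b], 0)) ` letters" by (simp only: Sigma_eq Un_iff simp_thms)
  then obtain b where b: "a = (cls [b], 0)" "b \<in> letters" by (rule imageE)
  have d: "decode a \<in> letters \<and> cls [decode a] = fst a"
    unfolding decode_def by (rule someI[of _ b]) (simp add: b)
  show ?thesis
  proof (rule that(2))
    show "fst a \<noteq> cls []" using letter_nontrivial[OF b(2)] by (simp add: b(1))
    show "decode a \<in> letters" using d by simp
    show "a = (cls [decode a], 0)" using d by (simp add: b(1))
  qed fact
qed

lemma T_letters_Sigma: "T_letters \<subseteq> \<Sigma>"
  by (simp add: Sigma_eq)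

text \<open>Moves the powers of \<open>t\<close> to the right end while reading: the state \<open>(n, k)\<close> stands for \<open>n t\<^sup>k\<close>, and
  a letter \<open>b\<close> read in that state passes \<open>t\<^sup>k\<close> as \<open>\<phi>\<^sup>-\<^sup>k(b)\<close>.\<close>

definition read_letter :: "'v signed_word \<times> int \<Rightarrow> 'v signed_word set \<times> int \<Rightarrow> 'v signed_word \<times> int" where
  "read_letter s a = (fst s @ (if a \<in> T_letters then [] else [flip (twist (snd s)) (decode a)]),
    (snd s + snd a) mod int m)"

definition parse :: "('v signed_word set \<times> int) list \<Rightarrow> 'v signed_word \<times> int" where
  "parse W = foldl read_letter ([], 0) W"

lemma parse_snoc: "parse (W @ [a]) = read_letter (parse W) a"
  by (simp add: parse_def)

lemma parse_snd: "snd (parse W) = (\<Sum>a\<leftarrow>W. snd a) mod int m"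
  by (induction W rule: rev_induct) (simp_all add: parse_snoc read_letter_def parse_def[of "[]"] mod_simps)

lemma Sigma_carrier: "\<Sigma> \<subseteq> carrier G"
  using pos by (auto simp: Sigma_eq T_letters_def carrier_G cls_carrier)

lemma word_val_append:
  assumes "U \<in> lists \<Sigma>" "W \<in> lists \<Sigma>"
  shows "word_val G (U @ W) = word_val G U \<otimes>\<^bsub>G\<^esub> word_val G W"
proof -
  interpret G: group G by (rule grp)
  show ?thesis using G.word_val_append[of U W] assms Sigma_carrier lists_mono by blast
qed

lemma word_val_letter: "a \<in> \<Sigma> \<Longrightarrow> word_val G [a] = a"
  using Sigma_carrier group.is_monoid[OF grp] by (auto simp: word_val_def monoid.r_one)

lemma parse_word_val:
  assumes "W \<in> lists \<Sigma>"
  shows "fst (parse W) \<in> lists letters \<and> word_val G W = (cls (fst (parse W)), snd (parse W)) \<and>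
    length W = length (filter (\<lambda>a. a \<in> T_letters) W) + length (fst (parse W))"
  using assms
proof (induction W rule: rev_induct)
  case Nil
  show ?case by (simp add: parse_def word_val_def one_G)
next
  case (snoc a W)
  then have W: "W \<in> lists \<Sigma>" and a: "a \<in> \<Sigma>" by auto
  note IH = snoc.IH[OF W]
  have val: "word_val G (W @ [a]) = (cls (fst (parse W)), snd (parse W)) \<otimes>\<^bsub>G\<^esub> a"
    using word_val_append[OF W, of "[a]"] word_val_letter[OF a] a IH by simp
  from a show ?case
  proof (cases rule: letter_cases)
    case 1
    have "word_val G (W @ [a]) = (cls (fst (parse W)), (snd (parse W) + snd a) mod int m)"
      unfolding val by (subst 1(2)) (use IH in \<open>simp add: mult_G\<close>)
    then show ?thesis using 1 IH by (simp add: parse_snoc read_letter_def)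
  next
    case 2
    have l: "flip (twist (snd (parse W))) (decode a) \<in> letters" using 2(2) by (auto simp: flip_def)
    have "word_val G (W @ [a]) =
      (cls (fst (parse W) @ [flip (twist (snd (parse W))) (decode a)]), snd (parse W) mod int m)"
      unfolding val by (subst 2(3)) (use IH 2(2) mult_G[of "fst (parse W)" "[decode a]"] in simp)
    moreover have "snd a = 0" by (subst 2(3)) simp
    ultimately show ?thesis using 2(4) IH l by (simp add: parse_snoc read_letter_def)
  qed
qed

text \<open>The length of \<open>t\<^sup>k\<close> in the cyclic group: the smaller of \<open>k\<close> and \<open>m - k\<close> for \<open>0 \<le> k < m\<close>.\<close>

definition t_cost :: "int \<Rightarrow> nat" where
  "t_cost k = Inf (length ` {W \<in> lists T_letters. (\<Sum>a\<leftarrow>W. snd a) mod int m = k})"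

lemma t_cost_attained:
  assumes "k \<in> {0..<int m}"
  shows "\<exists>W\<in>lists T_letters. (\<Sum>a\<leftarrow>W. snd a) mod int m = k \<and> length W = t_cost k"
    and "t_cost k < m"
proof -
  let ?W = "replicate (nat k) (cls [], 1 mod int m)"
  have "(\<Sum>a\<leftarrow>?W. snd a) = int (nat k) * (1 mod int m)" by (simp add: sum_list_replicate)
  then have "(\<Sum>a\<leftarrow>?W. snd a) mod int m = k mod int m" using assms by (simp add: mod_simps)
  then have W: "?W \<in> {W \<in> lists T_letters. (\<Sum>a\<leftarrow>W. snd a) mod int m = k}"
    using assms by (auto simp: T_letters_def)
  then have "length ?W \<in> length ` {W \<in> lists T_letters. (\<Sum>a\<leftarrow>W. snd a) mod int m = k}"
    by (rule imageI)
  from Inf_nat_def1[of "length ` {W \<in> lists T_letters. (\<Sum>a\<leftarrow>W. snd a) mod int m = k}"] this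
  show "\<exists>W\<in>lists T_letters. (\<Sum>a\<leftarrow>W. snd a) mod int m = k \<and> length W = t_cost k"
    unfolding t_cost_def by fastforce
  have "t_cost k \<le> length ?W" unfolding t_cost_def by (rule cInf_lower[OF imageI[OF W]]) simp
  also have "length ?W < m" using assms by (simp add: nat_less_iff)
  finally show "t_cost k < m" .
qed

lemma t_cost_le:
  assumes "W \<in> lists \<Sigma>"
  shows "t_cost (snd (parse W)) \<le> length (filter (\<lambda>a. a \<in> T_letters) W)"
proof -
  have "(\<Sum>a\<leftarrow>W. snd a) = (\<Sum>a\<leftarrow>filter (\<lambda>a. a \<in> T_letters) W. snd a)"
    using assms
  proof (induction W)
    case (Cons a W)
    then have "a \<in> T_letters \<or> snd a = 0" by (auto simp: Sigma_eq)
    with Cons show ?case by auto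
  qed simp
  then have "filter (\<lambda>a. a \<in> T_letters) W \<in> {U \<in> lists T_letters. (\<Sum>a\<leftarrow>U. snd a) mod int m = snd (parse W)}"
    by (auto simp: parse_snd)
  then show ?thesis unfolding t_cost_def by (intro cInf_lower) auto
qed

text \<open>The upper bound is attained by a geodesic for \<open>n\<close> followed by a shortest power of \<open>t\<close>; the lower
  bound holds because reading a word uses each letter for one of the two parts.\<close>

lemma word_norm_eq:
  assumes n: "n \<in> lists letters" and k: "k \<in> {0..<int m}"
  shows "word_norm G \<Sigma> (cls n, k) = glen n + t_cost k"
  unfolding word_norm_def
proof (rule cInf_eq_minimum)
  have nf: "nf n \<in> lists letters" "cls (nf n) = cls n"
    using pres_cong_lists[OF nf_pres_cong[OF n]] equiv_class_eq[OF equiv_pres_cong nf_pres_cong[OF n]]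
    by auto
  have enc: "word_val G (map (\<lambda>b. (cls [b], 0)) u) = (cls u, 0)" if "u \<in> lists letters" for u
    using that
  proof (induction u)
    case (Cons b u)
    then have u: "u \<in> lists letters" and b: "[b] \<in> lists letters" by auto
    show ?case using Cons.IH mult_G[OF b u, of 0 0]
      by (simp add: word_val_def twist_def)
  qed (simp add: word_val_def one_G)
  obtain U where U: "U \<in> lists T_letters" "(\<Sum>a\<leftarrow>U. snd a) mod int m = k" "length U = t_cost k"
    using t_cost_attained[OF k] by blast
  have US: "U \<in> lists \<Sigma>" using U(1) T_letters_Sigma lists_mono by blast
  have "filter (\<lambda>a. a \<in> T_letters) U = U" using U(1) by (auto simp: filter_id_conv)
  with parse_word_val[OF US] have valU: "word_val G U = (cls [], k)"
    using U(2) by (simp add: parse_snd)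
  let ?W = "map (\<lambda>b. (cls [b], 0)) (nf n) @ U"
  have M: "map (\<lambda>b. (cls [b], 0)) (nf n) \<in> lists \<Sigma>"
    using nf(1) by (auto simp: Sigma_eq simp del: mem_Times_iff mem_Sigma_iff)
  have "word_val G ?W = (cls n, k)"
    using word_val_append[OF M US] enc[OF nf(1)] valU mult_G[OF nf(1), of "[]" 0 k] nf(2) k by simp
  moreover have "?W \<in> lists \<Sigma>" using M US by simp
  moreover have "length ?W = glen n + t_cost k" by (simp add: U(3) glen_def)
  ultimately show "glen n + t_cost k \<in> length ` {w \<in> lists \<Sigma>. word_val G w = (cls n, k)}"
    by (metis (mono_tags, lifting) imageI mem_Collect_eq)
next
  fix l assume "l \<in> length ` {w \<in> lists \<Sigma>. word_val G w = (cls n, k)}"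
  then obtain W where W: "W \<in> lists \<Sigma>" "word_val G W = (cls n, k)" "l = length W" by blast
  note p = parse_word_val[OF W(1)]
  have "cls (fst (parse W)) = cls n" "snd (parse W) = k" using p W(2) by auto
  with p n have "glen n \<le> length (fst (parse W))"
    using cls_glen[of "fst (parse W)" n] glen_le_length[of "fst (parse W)"] by auto
  then show "glen n + t_cost k \<le> l"
    using p W(3) t_cost_le[OF W(1)] \<open>snd (parse W) = k\<close> by auto
qed

text \<open>For \<open>K = g t\<^sup>j\<close>, comparing both sides of \<open>K (n' t\<^sup>k) = (n t\<^sup>k) K\<close> shows that
  \<open>n'\<close>, with signs flipped according to \<open>j\<close>, is the twisted conjugate \<open>g\<^sup>-\<^sup>1 n \<phi>\<^sup>-\<^sup>k(g)\<close>;
  the flip does not change the length, so the conjugators with \<open>j = 0\<close> give all values.\<close>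

lemma conj_class_norms:
  assumes n: "n \<in> lists letters" and k: "k \<in> {0..<int m}"
  shows "word_norm G \<Sigma> ` conj_class G (cls n, k) =
    (\<lambda>g. glen (inv_word g @ n @ map (flip (twist k)) g) + t_cost k) ` lists letters" (is "?L = ?R")
proof -
  interpret G: group G by (rule grp)
  have v: "(cls n, k) \<in> carrier G" using n k by (simp add: carrier_G cls_carrier)
  have key: "word_norm G \<Sigma> (inv\<^bsub>G\<^esub> K \<otimes>\<^bsub>G\<^esub> (cls n, k) \<otimes>\<^bsub>G\<^esub> K) =
      glen (inv_word g @ n @ map (flip (twist k)) g) + t_cost k"
    if K: "K = (cls g, j)" "g \<in> lists letters" "j \<in> {0..<int m}" for K g j
  proof -
    let ?c = "inv\<^bsub>G\<^esub> K \<otimes>\<^bsub>G\<^esub> (cls n, k) \<otimes>\<^bsub>G\<^esub> K"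
    have Kc: "K \<in> carrier G" using K by (simp add: carrier_G cls_carrier)
    then have "?c \<in> carrier G" using v by simp
    then obtain n' k' where c: "?c = (cls n', k')" "n' \<in> lists letters" "k' \<in> {0..<int m}"
      by (rule carrier_G_cases)
    have "K \<otimes>\<^bsub>G\<^esub> ?c = (cls n, k) \<otimes>\<^bsub>G\<^esub> K"
      using Kc v by (simp add: G.m_assoc[symmetric])
    then have "K \<otimes>\<^bsub>G\<^esub> (cls n', k') = (cls n, k) \<otimes>\<^bsub>G\<^esub> K" by (simp only: c(1))
    then have "(cls g, j) \<otimes>\<^bsub>G\<^esub> (cls n', k') = (cls n, k) \<otimes>\<^bsub>G\<^esub> (cls g, j)"
      by (simp only: K(1))
    then have eq: "cls (g @ map (flip (twist j)) n') = cls (n @ map (flip (twist k)) g)"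
      "(j + k') mod int m = (k + j) mod int m"
      using K(2) c(2) n by (simp_all add: mult_G)
    have "int m dvd (j + k') - (k + j)" using eq(2) by (simp add: mod_eq_dvd_iff)
    then have "k' mod int m = k mod int m" by (simp add: mod_eq_dvd_iff)
    then have kk: "k' = k" using c(3) k by simp
    have "(g @ map (flip (twist j)) n', n @ map (flip (twist k)) g) \<in> pres_cong V (raag_rels E)"
      using eq(1) K(2) c(2) n map_flip_lists[of n' V "twist j"] map_flip_lists[of g V "twist k"]
      by (subst (asm) cls_eq_iff) (simp_all only: append_in_lists_conv simp_thms)
    from pres_cong.append[OF pres_cong.refl[OF inv_word_lists[OF K(2)]] this]
    have "(inv_word g @ g @ map (flip (twist j)) n', inv_word g @ n @ map (flip (twist k)) g)
        \<in> pres_cong V (raag_rels E)" .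
    moreover have "((inv_word g @ g) @ map (flip (twist j)) n', [] @ map (flip (twist j)) n')
        \<in> pres_cong V (raag_rels E)"
      using K(2) c(2) by (intro pres_cong.append pres_cong_inv_word pres_cong.refl map_flip_lists)
    ultimately have "glen (inv_word g @ n @ map (flip (twist k)) g) = glen (map (flip (twist j)) n')"
      by (auto dest!: pres_cong_glen)
    then show ?thesis unfolding c(1) kk using word_norm_eq[OF c(2), of k] k by simp
  qed
  show ?thesis
  proof (intro equalityI subsetI)
    fix l assume "l \<in> ?L"
    then obtain K where K: "K \<in> carrier G" "l = word_norm G \<Sigma> (inv\<^bsub>G\<^esub> K \<otimes>\<^bsub>G\<^esub> (cls n, k) \<otimes>\<^bsub>G\<^esub> K)"
      by (auto simp: conj_class_def)
    from K(1) obtain g j where "K = (cls g, j)" "g \<in> lists letters" "j \<in> {0..<int m}"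
      by (rule carrier_G_cases)
    with key[OF this] K(2) show "l \<in> ?R" by blast
  next
    fix l assume "l \<in> ?R"
    then obtain g where g: "g \<in> lists letters" "l = glen (inv_word g @ n @ map (flip (twist k)) g) + t_cost k"
      by blast
    then have "l = word_norm G \<Sigma> (inv\<^bsub>G\<^esub> (cls g, 0) \<otimes>\<^bsub>G\<^esub> (cls n, k) \<otimes>\<^bsub>G\<^esub> (cls g, 0))"
      using key[OF HOL.refl g(1), of 0] pos by simp
    moreover have "(cls g, 0) \<in> carrier G" using g(1) pos by (simp add: carrier_G cls_carrier)
    ultimately show "l \<in> ?L" unfolding conj_class_def by blast
  qed
qed

text \<open>Both contributions to the length of \<open>W\<close> are at least the least possible ones, so \<open>W\<close> is
  minimal exactly if both are.\<close>

lemma ConjGeo_iff: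
  assumes W: "W \<in> lists \<Sigma>"
  shows "W \<in> ConjGeo G \<Sigma> \<longleftrightarrow>
    length (filter (\<lambda>a. a \<in> T_letters) W) = t_cost (snd (parse W)) \<and>
    glen (fst (parse W)) = length (fst (parse W)) \<and>
    (\<forall>a\<in>letters. \<not> removable_pair a (flip (twist (snd (parse W))) a) (fst (parse W)))"
proof -
  obtain n k where nk: "parse W = (n, k)" by fastforce
  let ?c = "length (filter (\<lambda>a. a \<in> T_letters) W)"
  let ?N = "\<lambda>g. glen (inv_word g @ n @ map (flip (twist k)) g)"
  have n: "n \<in> lists letters" and val: "word_val G W = (cls n, k)" and len: "length W = ?c + length n"
    using parse_word_val[OF W] by (simp_all add: nk)
  have k: "k \<in> {0..<int m}" using parse_snd[of W] pos by (simp add: nk)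
  have c: "t_cost k \<le> ?c" using t_cost_le[OF W] by (simp add: nk)
  let ?M = "(\<lambda>g. ?N g + t_cost k) ` lists letters"
  have "W \<in> ConjGeo G \<Sigma> \<longleftrightarrow> length W = Inf ?M"
    using W by (simp add: ConjGeo_def val conj_class_norms[OF n k])
  also have "\<dots> \<longleftrightarrow> (\<forall>g\<in>lists letters. length W \<le> ?N g + t_cost k)"
  proof
    assume "length W = Inf ?M"
    then show "\<forall>g\<in>lists letters. length W \<le> ?N g + t_cost k" by (auto intro!: cInf_lower)
  next
    assume *: "\<forall>g\<in>lists letters. length W \<le> ?N g + t_cost k"
    have "length W = ?N [] + t_cost k"
      using bspec[OF *, of "[]"] len c glen_le_length[of n] by simp
    then have "length W \<in> ?M" by (intro image_eqI[of _ _ "[]"]) simp_all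
    then show "length W = Inf ?M" using * by (intro cInf_eq_minimum[symmetric]) auto
  qed
  also have "\<dots> \<longleftrightarrow> ?c = t_cost k \<and> (\<forall>g\<in>lists letters. length n \<le> ?N g)"
  proof
    assume *: "\<forall>g\<in>lists letters. length W \<le> ?N g + t_cost k"
    have "?c = t_cost k" using bspec[OF *, of "[]"] len c glen_le_length[of n] by simp
    then show "?c = t_cost k \<and> (\<forall>g\<in>lists letters. length n \<le> ?N g)" using * len by auto
  qed (use len in auto)
  finally show ?thesis by (simp only: twisted_minimal_iff[OF n] nk fst_conv snd_conv)
qed

lemma regular_ConjGeo: "regular_language \<Sigma> (ConjGeo G \<Sigma>)"
proof -
  let ?t = "\<lambda>W. length (filter (\<lambda>a. a \<in> T_letters) W)"
  \<comment> \<open>Counting the letters \<open>t\<^sup>\<plusminus>\<^sup>1\<close> up to \<open>m\<close> suffices, since every cost is less than \<open>m\<close>.\<close>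
  define f where "f W = (min (?t W) m, snd (parse W), profile V (fst (parse W)))" for W
  have V: "finite V" using graph by (simp add: finite_simple_graph_def)
  show ?thesis
  proof (rule regular_language_right_congruence[where f = f])
    show "finite \<Sigma>" using V by (simp add: Sigma_eq T_letters_def)
    have "f ` lists \<Sigma> \<subseteq> {..m} \<times> {0..<int m} \<times> range (profile V)"
      using pos by (auto simp: f_def parse_snd)
    then show "finite (f ` lists \<Sigma>)"
      by (rule finite_subset) (simp add: finite_range_profile[OF V])
    show "ConjGeo G \<Sigma> \<subseteq> lists \<Sigma>" by (auto simp: ConjGeo_def)
  next
    fix U W a assume *: "U \<in> lists \<Sigma>" "W \<in> lists \<Sigma>" "a \<in> \<Sigma>" "f U = f W"
    then have eq: "min (?t U) m = min (?t W) m" "snd (parse U) = snd (parse W)"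
      "profile V (fst (parse U)) = profile V (fst (parse W))" by (simp_all add: f_def)
    from *(3) show "f (U @ [a]) = f (W @ [a])"
    proof (cases rule: letter_cases)
      case 1
      then show ?thesis using eq by (auto simp: f_def parse_snoc read_letter_def)
    next
      case 2
      have "flip (twist (snd (parse W))) (decode a) \<in> letters" using 2(2) by (auto simp: flip_def)
      from profile_snoc[OF this eq(3)] 2 eq show ?thesis
        by (simp add: f_def parse_snoc read_letter_def)
    qed
  next
    fix U W assume *: "U \<in> lists \<Sigma>" "W \<in> lists \<Sigma>" "f U = f W" and U: "U \<in> ConjGeo G \<Sigma>"
    then have eq: "min (?t U) m = min (?t W) m" "snd (parse U) = snd (parse W)"
      "profile V (fst (parse U)) = profile V (fst (parse W))" by (simp_all add: f_def)
    have "t_cost (snd (parse W)) < m"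
      using pos by (intro t_cost_attained(2)) (simp add: parse_snd)
    then have "?t U = t_cost (snd (parse W)) \<longleftrightarrow> ?t W = t_cost (snd (parse W))"
      using eq(1) by (auto simp: min_def split: if_splits)
    then show "W \<in> ConjGeo G \<Sigma>"
      using U profile_eq_minimal[OF eq(3), of "twist (snd (parse W))"]
      unfolding ConjGeo_iff[OF *(1)] ConjGeo_iff[OF *(2)] eq(2) by blast
  qed
qed

end

text \<open>Every inversion maps the set consisting of a generator and its inverse to itself.\<close>

lemma inversions_product_generator:
  assumes "set \<sigma>s \<subseteq> inversions V E" "x \<in> V"
  shows "word_val (AutoGroup (raag V E)) \<sigma>s \<in> carrier (AutoGroup (raag V E)) \<and>
    word_val (AutoGroup (raag V E)) \<sigma>s (raag_gen V E x) \<in>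
      {raag_gen V E x, inv\<^bsub>raag V E\<^esub> raag_gen V E x}"
  using assms(1)
proof (induction \<sigma>s)
  case Nil
  interpret AA: group "AutoGroup (raag V E)" by (rule group.AutoGroup[OF group_raag])
  show ?case using raag_gen_carrier[OF assms(2)] by (simp add: word_val_def AutoGroup_one_apply)
next
  case (Cons \<sigma> \<sigma>s)
  interpret AA: group "AutoGroup (raag V E)" by (rule group.AutoGroup[OF group_raag])
  interpret R: group "raag V E" by (rule group_raag)
  let ?g = "raag_gen V E x" and ?\<tau> = "word_val (AutoGroup (raag V E)) \<sigma>s"
  have g: "?g \<in> carrier (raag V E)" by (rule raag_gen_carrier[OF assms(2)])
  have \<sigma>: "\<sigma> \<in> carrier (AutoGroup (raag V E))" using Cons.prems by (auto simp: inversions_def)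
  interpret h: group_hom "raag V E" "raag V E" \<sigma>
    using AutoGroup_hom[OF \<sigma>] by unfold_locales
  obtain y where y: "y \<in> V" "\<sigma> (raag_gen V E y) = inv\<^bsub>raag V E\<^esub> raag_gen V E y"
    "\<forall>z\<in>V - {y}. \<sigma> (raag_gen V E z) = raag_gen V E z"
    using Cons.prems by (auto simp: inversions_def)
  have \<sigma>g: "\<sigma> ?g \<in> {?g, inv\<^bsub>raag V E\<^esub> ?g}" using y assms(2) by (cases "x = y") auto
  have \<tau>: "?\<tau> \<in> carrier (AutoGroup (raag V E))" "?\<tau> ?g \<in> {?g, inv\<^bsub>raag V E\<^esub> ?g}"
    using Cons by auto
  have "word_val (AutoGroup (raag V E)) (\<sigma> # \<sigma>s) ?g = \<sigma> (?\<tau> ?g)"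
    using AutoGroup_mult_apply[OF \<sigma> \<tau>(1) g] by (simp add: word_val_def)
  moreover have "\<sigma> (?\<tau> ?g) \<in> {?g, inv\<^bsub>raag V E\<^esub> ?g}"
    using \<tau>(2) \<sigma>g g by auto
  ultimately show ?case using \<sigma> \<tau>(1) by (simp add: word_val_def)
qed

lemma generators_inverted_flips:
  assumes aut: "\<phi> \<in> carrier (AutoGroup (raag V E))"
    and gen: "\<And>x. x \<in> V \<Longrightarrow> \<phi> (raag_gen V E x) \<in> {raag_gen V E x, inv\<^bsub>raag V E\<^esub> raag_gen V E x}"
    and w: "w \<in> lists (V \<times> UNIV)"
  defines "T \<equiv> {x \<in> V. \<phi> (raag_gen V E x) \<noteq> raag_gen V E x}"
  shows "\<phi> (pres_cong V (raag_rels E) `` {w}) = pres_cong V (raag_rels E) `` {map (flip T) w}"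
  using w
proof (induction w)
  interpret h: group_hom "raag V E" "raag V E" \<phi>
    using AutoGroup_hom[OF aut] group_raag by (simp add: group_hom_def group_hom_axioms_def)
  let ?C = "\<lambda>w. pres_cong V (raag_rels E) `` {w}"
  have C: "?C w \<in> carrier (raag V E)" if "w \<in> lists (V \<times> UNIV)" for w
    using presented_class_carrier[OF that] by (simp add: raag_def)
  have mult: "?C [a] \<otimes>\<^bsub>raag V E\<^esub> ?C w = ?C (a # w)" if "a # w \<in> lists (V \<times> UNIV)" for a w
    using presented_mult_class[of "[a]" V w] that by (simp add: raag_def)
  {
    case Nil
    show ?case using h.hom_one by (simp add: raag_def presented_group_def)
  next
    case (Cons a w)
    then have a: "a \<in> V \<times> UNIV" and w: "w \<in> lists (V \<times> UNIV)" by auto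
    obtain x b where ab: "a = (x, b)" "x \<in> V" using a by auto
    have x: "raag_gen V E x \<in> carrier (raag V E)" by (rule raag_gen_carrier[OF ab(2)])
    have ne: "\<phi> (raag_gen V E x) = (if x \<in> T then inv\<^bsub>raag V E\<^esub> raag_gen V E x else raag_gen V E x)"
      using gen[OF ab(2)] ab(2) by (auto simp: T_def)
    have letter: "?C [(x, b)] = (if b then raag_gen V E x else inv\<^bsub>raag V E\<^esub> raag_gen V E x)" for b
      using inv_raag_gen[OF ab(2), of E] by (simp add: raag_gen_def)
    have 1: "\<phi> (?C [a]) = ?C [flip T a]"
      using x ne h.hom_inv[OF x] by (auto simp: ab flip_def letter)
    have fl: "flip T a # map (flip T) w \<in> lists (V \<times> UNIV)" using map_flip_lists[of "a # w" V T] a w by simp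
    have "\<phi> (?C (a # w)) = \<phi> (?C [a]) \<otimes>\<^bsub>raag V E\<^esub> \<phi> (?C w)"
      using mult[of a w] h.hom_mult[OF C[of "[a]"] C[OF w]] a w by simp
    also have "\<dots> = ?C (map (flip T) (a # w))"
      using mult[OF fl] Cons.IH by (simp add: 1)
    finally show ?case .
  }
qed

theorem corollary5p7:
  fixes V :: "'v set" and E :: "'v set set"
    and \<phi> :: "'v signed_word set \<Rightarrow> 'v signed_word set" and m :: nat
  assumes "finite_simple_graph V E"
    and "\<phi> \<in> carrier (AutoGroup (raag V E))"
    and "\<exists>\<sigma>s. set \<sigma>s \<subseteq> inversions V E \<and> \<phi> = word_val (AutoGroup (raag V E)) \<sigma>s"
    and "m > 0"
    and "\<phi> [^]\<^bsub>AutoGroup (raag V E)\<^esub> m = \<one>\<^bsub>AutoGroup (raag V E)\<^esub>"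
  shows "regular_language (ext_raag_gens V E \<phi> m)
    (ConjGeo (cyclic_extension (raag V E) \<phi> m) (ext_raag_gens V E \<phi> m))"
proof -
  obtain \<sigma>s where \<sigma>s: "set \<sigma>s \<subseteq> inversions V E" "\<phi> = word_val (AutoGroup (raag V E)) \<sigma>s"
    using assms(3) by blast
  have gen: "\<phi> (raag_gen V E x) \<in> {raag_gen V E x, inv\<^bsub>raag V E\<^esub> raag_gen V E x}" if "x \<in> V" for x
    using inversions_product_generator[OF \<sigma>s(1) that] \<sigma>s(2) by simp
  interpret inverting_extension V E \<phi> m "{x \<in> V. \<phi> (raag_gen V E x) \<noteq> raag_gen V E x}"
    using assms generators_inverted_flips[OF assms(2) gen] by unfold_locales auto
  show ?thesis by (rule regular_ConjGeo)
qed

end
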